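(* Fix an admissible quadruple $(z,z',w,w')$. The family of probability measures $\{M_{z,z',w,w'\mid N}\}_{N\ge1}$ is coherent, i.e. for every $N\ge2$ and every $\lambda\in\mathbb S_{N-1}$, $$\sum_{\nu\in\mathbb S_N}M_{z,z',w,w'\mid N}(\nu)\,\Lambda^N_{N-1}(\nu,\lambda)=M_{z,z',w,w'\mid N-1}(\lambda).$$
   Context: Signatures and links: - $\mathbb S_N$ is the set of integer $N$-tuples $\nu_1\ge\dots\ge\nu_N$. - $\mathrm{Dim}_N\nu=\prod_{1\le i<j\le N}\frac{\nu_i-\nu_j-i+j}{j-i}$. - For $\lambda\in\mathbb S_{N-1}$ and $\nu\in\mathbb S_N$, write $\lambda\prec\nu$ if $\nu_i\ge\lambda_i\ge\nu_{i+1}$ for all $i$. - The link is $\Lambda^N_{N-1}(\nu,\lambda)=\mathrm{Dim}_{N-1}\lambda/\mathrm{Dim}_N\nu$ if $\lambda\prec\nu$, and $0$ otherwise. Admissibility: a quadruple $(z,z',w,w')\in\mathbb C^4$ is admissible if both of the following hold: - $(z+k)(z'+k)>0$ and $(w+k)(w'+k)>0$ for all $k\in\mathbb Z$; - $\mathrm{Re}(z+z'+w+w')>-1$. The zw-measures: $M_{z,z',w,w'\mid N}(\nu)=M'_{z,z',w,w'\mid N}(\nu)/C_{z,z',w,w'\mid N}$, where $$M'_{z,z',w,w'\mid N}(\nu)=\prod_{i=1}^N\frac{1}{\Gamma(z-\nu_i+i)\Gamma(z'-\nu_i+i)\Gamma(w+N+1+\nu_i-i)\Gamma(w'+N+1+\nu_i-i)}\,(\mathrm{Dim}_N\nu)^2$$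 and $$C_{z,z',w,w'\mid N}=\prod_{i=1}^N\frac{\Gamma(z+z'+w+w'+i)}{\Gamma(z+w+i)\Gamma(z+w'+i)\Gamma(z'+w+i)\Gamma(z'+w'+i)\Gamma(i)}.$$ This is a probability measure on $\mathbb S_N$. *)

theory Defs
  imports "HOL-Analysis.Analysis"
begin

text \<open>Signatures of length N are represented as int lists of length N; the
paper's 1-based coordinate nu_i is sig_at nu i = nu ! (i - 1).\<close>

definition sig_at :: "int list \<Rightarrow> nat \<Rightarrow> int" where
  "sig_at \<nu> i = \<nu> ! (i - 1)"

definition sigs :: "nat \<Rightarrow> int list set" where
  "sigs N = {\<nu>. length \<nu> = N \<and> (\<forall>i\<in>{1..<N}. sig_at \<nu> i \<ge> sig_at \<nu> (i + 1))}"

definition Dim :: "nat \<Rightarrow> int list \<Rightarrow> real" where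
  "Dim N \<nu> = (\<Prod>(i, j)\<in>{(i, j). 1 \<le> i \<and> i < j \<and> j \<le> N}.
      (real_of_int (sig_at \<nu> i - sig_at \<nu> j) - real i + real j) / (real j - real i))"

definition interlace :: "nat \<Rightarrow> int list \<Rightarrow> int list \<Rightarrow> bool" where
  "interlace N \<mu> \<nu> \<longleftrightarrow> (\<forall>i\<in>{1..<N}. sig_at \<nu> i \<ge> sig_at \<mu> i \<and> sig_at \<mu> i \<ge> sig_at \<nu> (i + 1))"

definition link :: "nat \<Rightarrow> int list \<Rightarrow> int list \<Rightarrow> real" where
  "link N \<nu> \<mu> = (if interlace N \<mu> \<nu> then Dim (N - 1) \<mu> / Dim N \<nu> else 0)"

definition pos_complex :: "complex \<Rightarrow> bool" where
  "pos_complex c \<longleftrightarrow> Im c = 0 \<and> Re c > 0"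

definition admissible :: "complex \<Rightarrow> complex \<Rightarrow> complex \<Rightarrow> complex \<Rightarrow> bool" where
  "admissible z z' w w' \<longleftrightarrow>
     (\<forall>k::int. pos_complex ((z + of_int k) * (z' + of_int k)) \<and>
               pos_complex ((w + of_int k) * (w' + of_int k))) \<and>
     Re (z + z' + w + w') > -1"

text \<open>1/Gamma is rendered by the entire reciprocal Gamma function rGamma.\<close>
definition zwM' :: "complex \<Rightarrow> complex \<Rightarrow> complex \<Rightarrow> complex \<Rightarrow> nat \<Rightarrow> int list \<Rightarrow> complex" where
  "zwM' z z' w w' N \<nu> =
     (\<Prod>i=1..N. rGamma (z - of_int (sig_at \<nu> i) + of_nat i)
              * rGamma (z' - of_int (sig_at \<nu> i) + of_nat i)
              * rGamma (w + of_nat N + 1 + of_int (sig_at \<nu> i) - of_nat i)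
              * rGamma (w' + of_nat N + 1 + of_int (sig_at \<nu> i) - of_nat i))
     * (complex_of_real (Dim N \<nu>))\<^sup>2"

definition zwC :: "complex \<Rightarrow> complex \<Rightarrow> complex \<Rightarrow> complex \<Rightarrow> nat \<Rightarrow> complex" where
  "zwC z z' w w' N =
     (\<Prod>i=1..N. Gamma (z + z' + w + w' + of_nat i)
        / (Gamma (z + w + of_nat i) * Gamma (z + w' + of_nat i) * Gamma (z' + w + of_nat i)
           * Gamma (z' + w' + of_nat i) * Gamma (of_nat i)))"

definition zwM :: "complex \<Rightarrow> complex \<Rightarrow> complex \<Rightarrow> complex \<Rightarrow> nat \<Rightarrow> int list \<Rightarrow> complex" where
  "zwM z z' w w' N \<nu> = zwM' z z' w w' N \<nu> / zwC z z' w w' N"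

end

theory Submission
  imports Defs "HOL-Library.Landau_Symbols" "Jordan_Normal_Form.Determinant"
begin

text \<open>In the coordinates \<open>x\<^sub>i = \<nu>\<^sub>i - i\<close>, \<open>y\<^sub>i = \<mu>\<^sub>i - i\<close>, interlacing reads
\<open>x\<^sub>1 \<ge> y\<^sub>1 > x\<^sub>2 \<ge> y\<^sub>2 > \<dots> > x\<^sub>N\<close>, so one sums over a product of disjoint integer intervals. With
\<open>f x = 1 / (\<Gamma>(z - x) \<Gamma>(z' - x) \<Gamma>(w + N + 1 + x) \<Gamma>(w' + N + 1 + x))\<close> the summand is a constant times
\<open>\<Prod> f x\<^sub>i\<close> times the Vandermonde determinant of the \<open>x\<^sub>i\<close>. Let \<open>g\<close> be the weight \<open>f\<close> of level
\<open>N - 1\<close>. The forward difference of \<open>g y * y ^ j\<close> is \<open>f y\<close> times a polynomial of degree \<open>j + 1\<close>; using these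
polynomials and the constant \<open>1\<close> as columns of the determinant, every column but one telescopes
over the intervals. What remains is the Vandermonde determinant of the \<open>y\<^sub>i\<close> times
\<open>\<Prod> g y\<^sub>i\<close> times the sum of \<open>f\<close> over all integers, which Dougall's bilateral formula evaluates.

For Dougall's formula, a contiguous relation (again by telescoping) shows that the quotient \<open>\<rho>\<close> of
both sides is periodic with period 1 in each of its four parameters. Letting \<open>m \<longrightarrow> \<infinity>\<close> in
\<open>\<rho> (a + m) b c (d + m)\<close> shows that \<open>\<rho>\<close> depends only on \<open>b, c\<close>; by symmetry it also depends only
on \<open>a, d\<close>. So it is constant, and a terminating case gives the value 1.\<close>

subsection \<open>Sums over the integers\<close>

lemma bigo_powr_imp_summable_on_int:
  fixes f :: "int \<Rightarrow> complex"
  assumes pos: "(\<lambda>n::nat. norm (f (int n))) \<in> O(\<lambda>n. real n powr e)"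
    and neg: "(\<lambda>n::nat. norm (f (- int n))) \<in> O(\<lambda>n. real n powr e)"
    and e: "e < -1"
  shows "f summable_on A"
proof -
  have *: "g summable_on (UNIV :: nat set)" if "(\<lambda>n. norm (g n)) \<in> O(\<lambda>n. real n powr e)" for g :: "nat \<Rightarrow> complex"
  proof (rule norm_summable_imp_summable_on)
    show "summable (\<lambda>n. norm (g n))"
      by (rule summable_comparison_test_bigo[where g = "\<lambda>n. real n powr e"])
         (use that e in \<open>simp_all add: summable_real_powr_iff\<close>)
  qed
  have "f summable_on (int ` UNIV)"
    by (subst summable_on_reindex) (use *[OF pos] in \<open>simp_all add: o_def\<close>)
  moreover have "f summable_on ((\<lambda>n. - int n) ` UNIV)"
    by (subst summable_on_reindex) (use *[OF neg] in \<open>simp_all add: o_def inj_def\<close>)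
  ultimately have "f summable_on (int ` UNIV \<union> (\<lambda>n. - int n) ` UNIV)"
    by (rule summable_on_union)
  moreover have "int ` UNIV \<union> (\<lambda>n. - int n) ` UNIV = UNIV"
    by (auto intro: int_cases2)
  ultimately show ?thesis
    using summable_on_subset[of f UNIV A] by simp
qed

lemma has_sum_telescope_Suc:
  fixes G :: "int \<Rightarrow> complex"
  assumes "a \<le> b"
  shows "((\<lambda>x. G (x + 1) - G x) has_sum (G b - G a)) {a..<b}"
proof (rule has_sum_finiteI)
  have "(\<Sum>x\<in>{a..<a + int n}. G (x + 1) - G x) = G (a + int n) - G a" for n
  proof (induction n)
    case (Suc n)
    have "{a..<a + int (Suc n)} = insert (a + int n) {a..<a + int n}" by auto
    with Suc show ?case by (simp add: algebra_simps)
  qed simp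
  from this[of "nat (b - a)"] show "G b - G a = (\<Sum>x\<in>{a..<b}. G (x + 1) - G x)"
    using assms by simp
qed simp

lemma has_sum_telescope_atLeast:
  fixes G :: "int \<Rightarrow> complex"
  assumes "(\<lambda>x. G (x + 1) - G x) summable_on {a..}"
    and "(\<lambda>n::nat. G (int n)) \<longlonglongrightarrow> 0"
  shows "((\<lambda>x. G (x + 1) - G x) has_sum (- G a)) {a..}"
proof -
  have bij: "bij_betw (\<lambda>n. a + int n) UNIV {a..}"
    by (rule bij_betwI[where g = "\<lambda>x. nat (x - a)"]) auto
  have lim: "(\<lambda>n. G (a + int n)) \<longlonglongrightarrow> 0"
  proof -
    have "filterlim (\<lambda>n. nat (a + int n)) sequentially sequentially"
      unfolding filterlim_at_top
    proof
      fix Z :: nat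
      show "\<forall>\<^sub>F n in sequentially. Z \<le> nat (a + int n)"
        using eventually_ge_at_top[of "Z + nat \<bar>a\<bar>"] by eventually_elim linarith
    qed
    from filterlim_compose[OF assms(2) this]
    show ?thesis
    proof (rule Lim_transform_eventually)
      show "\<forall>\<^sub>F n in sequentially. G (int (nat (a + int n))) = G (a + int n)"
        using eventually_ge_at_top[of "nat \<bar>a\<bar>"]
      proof eventually_elim
        case (elim n)
        hence "0 \<le> a + int n" by linarith
        thus ?case by simp
      qed
    qed
  qed
  obtain S where S: "((\<lambda>x. G (x + 1) - G x) has_sum S) {a..}"
    using assms(1) by (auto simp: summable_on_def)
  hence "((\<lambda>n. G (a + int n + 1) - G (a + int n)) has_sum S) UNIV"
    using has_sum_reindex_bij_betw[OF bij, of "\<lambda>x. G (x + 1) - G x"] by simp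
  hence "(\<lambda>n. G (a + int n + 1) - G (a + int n)) sums S"
    by (rule has_sum_imp_sums)
  moreover have "(\<lambda>n. G (a + int (Suc n)) - G (a + int n)) sums (0 - G (a + int 0))"
    by (rule telescope_sums[OF lim])
  ultimately have "S = - G a"
    using sums_unique2 by (fastforce simp: algebra_simps)
  with S show ?thesis by simp
qed

lemma has_sum_telescope_lessThan:
  fixes G :: "int \<Rightarrow> complex"
  assumes "(\<lambda>x. G (x + 1) - G x) summable_on {..<a}"
    and "(\<lambda>n::nat. G (- int n)) \<longlonglongrightarrow> 0"
  shows "((\<lambda>x. G (x + 1) - G x) has_sum G a) {..<a}"
proof -
  \<comment> \<open>The substitution x -> -x - 1, not x -> -x, carries forward differences of
    \<open>G\<close> to forward differences of \<open>H\<close>, and \<open>{..<a}\<close> onto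
    \<open>{- a..}\<close>.\<close>
  define H where "H = (\<lambda>x. - G (- x))"
  have eq: "((\<lambda>x. G (x + 1) - G x) has_sum S) {..<a} \<longleftrightarrow>
    ((\<lambda>x. H (x + 1) - H x) has_sum S) {- a..}" for S
    by (rule has_sum_reindex_bij_witness[of _ "\<lambda>x. - x - 1" "\<lambda>x. - x - 1"])
       (auto simp: H_def algebra_simps)
  have "((\<lambda>x. H (x + 1) - H x) has_sum (- H (- a))) {- a..}"
  proof (rule has_sum_telescope_atLeast)
    show "(\<lambda>x. H (x + 1) - H x) summable_on {- a..}"
      using assms(1) eq unfolding summable_on_def by blast
    show "(\<lambda>n. H (int n)) \<longlonglongrightarrow> 0"
      using tendsto_minus[OF assms(2)] by (simp add: H_def)
  qed
  with eq show ?thesis by (simp add: H_def)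
qed

lemma has_sum_telescope_UNIV:
  fixes G :: "int \<Rightarrow> complex"
  assumes "(\<lambda>x. G (x + 1) - G x) summable_on UNIV"
    and "(\<lambda>n::nat. G (int n)) \<longlonglongrightarrow> 0" and "(\<lambda>n::nat. G (- int n)) \<longlonglongrightarrow> 0"
  shows "((\<lambda>x. G (x + 1) - G x) has_sum 0) UNIV"
proof -
  have "((\<lambda>x. G (x + 1) - G x) has_sum (- G 0 + G 0)) ({0..} \<union> {..<0})"
    by (intro has_sum_Un_disjoint has_sum_telescope_atLeast has_sum_telescope_lessThan assms
          summable_on_subset[OF assms(1)]) auto
  moreover have "{0..} \<union> {..<0} = (UNIV :: int set)" by auto
  ultimately show ?thesis by simp
qed

text \<open>Dominated convergence over the integers: enumerating them by \<open>int_decode\<close>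
  reduces it to Tannery's theorem for series.\<close>

lemma infsum_dominated_tendsto_int:
  fixes f :: "nat \<Rightarrow> int \<Rightarrow> complex"
  assumes lim: "\<And>n. (\<lambda>m. f m n) \<longlonglongrightarrow> h n"
    and bound: "\<And>m n. norm (f m n) \<le> g n"
    and g: "g summable_on UNIV"
  shows "(\<lambda>m. infsum (f m) UNIV) \<longlonglongrightarrow> infsum h UNIV"
proof -
  have bij: "bij_betw int_decode UNIV UNIV" by (rule bij_int_decode)
  have sum: "k summable_on UNIV \<Longrightarrow> infsum k UNIV = (\<Sum>n. k (int_decode n))" for k :: "int \<Rightarrow> complex"
    using has_sum_reindex_bij_betw[OF bij, of k] has_sum_infsum[of k UNIV]
    by (metis has_sum_imp_sums sums_unique)
  have gs: "summable (\<lambda>n. g (int_decode n))"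
    using summable_on_reindex_bij_betw[OF bij, of g] g by (simp add: summable_on_imp_summable)
  have hb: "norm (h n) \<le> g n" for n
    by (rule tendsto_le[OF sequentially_bot tendsto_const tendsto_norm[OF lim]])
       (use bound in simp)
  have smb: "k summable_on UNIV" if "\<And>n. norm (k n) \<le> g n" for k :: "int \<Rightarrow> complex"
    by (rule summable_on_iff_abs_summable_on_complex[THEN iffD2], rule summable_on_comparison_test[OF g])
       (use that in auto)
  have "(\<lambda>m. \<Sum>n. f m (int_decode n)) \<longlonglongrightarrow> (\<Sum>n. h (int_decode n))"
    by (rule tannerys_theorem[THEN conjunct2, THEN conjunct2, OF _ _ gs])
       (use lim bound in \<open>auto simp: case_prod_unfold\<close>)
  thus ?thesis by (subst (1 2) sum) (use bound hb smb in blast)+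
qed

section \<open>Growth of the reciprocal Gamma function under integer shifts\<close>

lemma rGamma_plus_nat_asymptotics:
  fixes x :: complex
  shows "(\<lambda>n::nat. rGamma (x + of_nat n) * (fact n * exp ((x - 1) * of_real (ln (real n))))) \<longlonglongrightarrow> 1"
    (is "?E x \<longlonglongrightarrow> 1")
proof -
  \<comment> \<open>For Re x > 1 the number \<open>rGamma (x - 1)\<close> is nonzero, so the
    quotient by Euler's sequence \<open>rGamma_series\<close> tends to 1. The other x follow by
    downward recurrence, each step costing a factor x / n + 1 that tends to 1.\<close>
  have base: "?E x \<longlonglongrightarrow> 1" if "Re x > 1" for x
  proof -
    have nz: "rGamma (x - 1) \<noteq> 0"
    proof
      assume "rGamma (x - 1) = 0"
      then obtain k where k: "x - 1 = of_int k" "k \<le> 0"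
        by (auto simp: rGamma_eq_zero_iff elim!: nonpos_Ints_cases)
      from arg_cong[OF k(1), of Re] k(2) that show False by simp
    qed
    have "(\<lambda>n. rGamma (x - 1) / rGamma_series (x - 1) n) \<longlonglongrightarrow> rGamma (x - 1) / rGamma (x - 1)"
      using nz by (intro tendsto_intros)
    moreover have "rGamma (x - 1) / rGamma_series (x - 1) n = ?E x n" for n
    proof -
      have "rGamma (x - 1) = pochhammer (x - 1) (n + 1) * rGamma (x + of_nat n)"
        using pochhammer_rGamma[of "x - 1" "n + 1"] by (simp add: algebra_simps)
      with nz show ?thesis by (auto simp: rGamma_series_def field_simps)
    qed
    ultimately show ?thesis using nz by simp
  qed
  have step: "?E x \<longlonglongrightarrow> 1" if "?E (x + 1) \<longlonglongrightarrow> 1" for x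
  proof (rule Lim_transform_eventually)
    have "(\<lambda>n. x / of_nat n + 1) \<longlonglongrightarrow> 0 + 1"
      by (intro tendsto_intros lim_const_over_n)
    from tendsto_mult[OF this that]
    show "(\<lambda>n. (x / of_nat n + 1) * ?E (x + 1) n) \<longlonglongrightarrow> 1" by simp
    show "\<forall>\<^sub>F n in sequentially. (x / of_nat n + 1) * ?E (x + 1) n = ?E x n"
      using eventually_gt_at_top[of 0]
    proof eventually_elim
      case (elim n)
      have "exp (x * of_real (ln (real n))) = exp ((x - 1) * of_real (ln (real n))) * of_nat n"
        using elim by (simp add: algebra_simps exp_diff exp_of_real)
      moreover have "rGamma (x + of_nat n) = (x + of_nat n) * rGamma (x + 1 + of_nat n)"
        using rGamma_plus1[of "x + of_nat n"] by (simp add: add_ac)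
      ultimately show ?case using elim by (simp add: field_simps)
    qed
  qed
  have "?E (x + of_nat k) \<longlonglongrightarrow> 1 \<Longrightarrow> ?E x \<longlonglongrightarrow> 1" for k
  proof (induction k)
    case (Suc k)
    from Suc.prems step[of "x + of_nat k"] Suc.IH show ?case by (simp add: add_ac)
  qed simp
  moreover obtain k :: nat where "1 - Re x < real k" using reals_Archimedean2 by blast
  ultimately show ?thesis using base[of "x + of_nat k"] by (auto simp: algebra_simps)
qed

text \<open>Up to the sign (-1)^n, the factor \<open>rGamma (c - of_nat n)\<close> is a Pochhammer
  symbol of 1 - c times \<open>rGamma c\<close>, and Euler's sequence at -c gives the growth of that
  symbol. The factorials cancel, leaving n to the power 1 - b - c times a convergent, hence bounded,
  sequence.\<close>

lemma rGamma_pair_bigo: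
  fixes b c :: complex
  shows "(\<lambda>n::nat. norm (rGamma (b + of_nat n) * rGamma (c - of_nat n)))
    \<in> O(\<lambda>n. real n powr (1 - Re b - Re c))"
\<comment> \<open>Euler's sequence at -c carries a factor -c that has to be divided out, so c = 0 is
  separated; all terms vanish there.\<close>
proof (cases "c = 0")
  case True
  have "rGamma (c - of_nat n) = 0" for n
    using True by (simp add: rGamma_eq_zero_iff)
  thus ?thesis by simp
next
  case False
  define E where "E = (\<lambda>n::nat. rGamma (b + of_nat n) * (fact n * exp ((b - 1) * of_real (ln (real n)))))"
  define H where "H = (\<lambda>n. E n * rGamma_series (- c) n * (rGamma c / (- c)))"
  have H: "H \<longlonglongrightarrow> 1 * rGamma (- c) * (rGamma c / (- c))"
    unfolding H_def E_def using False
    by (intro tendsto_intros rGamma_plus_nat_asymptotics) auto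
  have eq: "rGamma (b + of_nat n) * rGamma (c - of_nat n) =
     (-1) ^ n * H n * exp ((1 - b - c) * of_real (ln (real n)))" if "n > 0" for n
  proof -
    have "rGamma (c - of_nat n) = pochhammer (c - of_nat n) n * rGamma c"
      using pochhammer_rGamma[of "c - of_nat n" n] by simp
    also have "pochhammer (c - of_nat n) n = (-1) ^ n * pochhammer (1 - c) n"
      using pochhammer_minus'[of c n] pochhammer_minus[of "c - 1" n] by (simp add: algebra_simps)
    finally have 1: "rGamma (c - of_nat n) = (-1) ^ n * pochhammer (1 - c) n * rGamma c" .
    have 2: "rGamma_series (- c) n = - c * pochhammer (1 - c) n / (fact n * exp (- c * of_real (ln (real n))))"
      using pochhammer_rec[of "- c" n] by (simp add: rGamma_series_def)
    have "exp ((b - 1) * of_real (ln (real n))) * exp ((1 - b - c) * of_real (ln (real n)))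
        = exp (- c * of_real (ln (real n)))"
      by (simp add: exp_add[symmetric] algebra_simps)
    thus ?thesis using False unfolding H_def E_def 1 2
      by (simp add: field_simps)
  qed
  have "(\<lambda>n. norm (H n) * norm (exp ((1 - b - c) * of_real (ln (real n)))))
      \<in> O(\<lambda>n. 1 * real n powr (1 - Re b - Re c))"
  proof (rule landau_o.big.mult)
    show "(\<lambda>n. norm (H n)) \<in> O(\<lambda>_. 1)"
      by (rule bigoI_tendsto[where c = "norm (1 * rGamma (- c) * (rGamma c / (- c)))"])
         (use tendsto_norm[OF H] in simp_all)
    show "(\<lambda>n. norm (exp ((1 - b - c) * of_real (ln (real n))))) \<in> O(\<lambda>n. real n powr (1 - Re b - Re c))"
      by (rule bigoI[where c = 1], rule eventually_mono[OF eventually_gt_at_top[of 0]])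
         (simp add: powr_def)
  qed
  also have "(\<lambda>n. norm (H n) * norm (exp ((1 - b - c) * of_real (ln (real n)))))
      \<in> O(\<lambda>n. 1 * real n powr (1 - Re b - Re c)) \<longleftrightarrow> ?thesis"
    unfolding mult_1
    by (intro landau_o.big.in_cong eventually_mono[OF eventually_gt_at_top[of 0]])
       (simp add: eq norm_mult norm_power)
  finally show ?thesis .
qed

subsection \<open>Dougall's bilateral sum\<close>

text \<open>By the reflection formula this is, for generic parameters and up to a factor independent
  of n, the summand of the bilateral hypergeometric series 2H2 at argument 1. Reciprocal Gamma
  factors make it entire in the parameters.\<close>

definition dougall_term :: "complex \<Rightarrow> complex \<Rightarrow> complex \<Rightarrow> complex \<Rightarrow> int \<Rightarrow> complex" where
  "dougall_term a b c d n =
     rGamma (a + of_int n) * rGamma (b + of_int n) * rGamma (c - of_int n) * rGamma (d - of_int n)"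

definition dougall_sum :: "complex \<Rightarrow> complex \<Rightarrow> complex \<Rightarrow> complex \<Rightarrow> complex" where
  "dougall_sum a b c d = infsum (dougall_term a b c d) UNIV"

definition dougall_value :: "complex \<Rightarrow> complex \<Rightarrow> complex \<Rightarrow> complex \<Rightarrow> complex" where
  "dougall_value a b c d = Gamma (a + b + c + d - 3) *
     rGamma (a + c - 1) * rGamma (a + d - 1) * rGamma (b + c - 1) * rGamma (b + d - 1)"

lemma rGamma_rec: "rGamma z = z * rGamma (z + 1)" for z :: complex
  by (simp add: rGamma_plus1)

lemma dougall_term_bigo:
  "(\<lambda>n::nat. norm (dougall_term a b c d (int n))) \<in> O(\<lambda>n. real n powr (2 - Re (a + b + c + d)))"
proof -
  have "(\<lambda>n::nat. norm (rGamma (a + of_nat n) * rGamma (c - of_nat n)) *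
                  norm (rGamma (b + of_nat n) * rGamma (d - of_nat n)))
    \<in> O(\<lambda>n. real n powr (1 - Re a - Re c) * real n powr (1 - Re b - Re d))"
    by (intro landau_o.big.mult rGamma_pair_bigo)
  thus ?thesis
    by (simp add: dougall_term_def norm_mult mult_ac powr_add[symmetric] algebra_simps)
qed

lemma dougall_term_bigo':
  "(\<lambda>n::nat. norm (dougall_term a b c d (- int n))) \<in> O(\<lambda>n. real n powr (2 - Re (a + b + c + d)))"
  using dougall_term_bigo[of c d a b] by (simp add: dougall_term_def mult_ac add_ac)

lemma dougall_summable: "Re (a + b + c + d) > 3 \<Longrightarrow> dougall_term a b c d summable_on A"
  by (rule bigo_powr_imp_summable_on_int[OF dougall_term_bigo dougall_term_bigo']) simp

lemma bigo_powr_neg_imp_tendsto_0: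
  fixes f :: "nat \<Rightarrow> complex"
  assumes "(\<lambda>n. norm (f n)) \<in> O(\<lambda>n. real n powr e)" "e < 0"
  shows "f \<longlonglongrightarrow> 0"
proof -
  have "(\<lambda>n. norm (f n)) \<longlonglongrightarrow> 0"
  proof -
    have "(\<lambda>n. real n powr e) \<in> o(\<lambda>_. 1)"
      using assms(2) by (intro smalloI_tendsto) (simp_all add: tendsto_neg_powr filterlim_real_sequentially)
    from landau_o.big_small_trans[OF assms(1) this]
    show ?thesis
      by (auto dest: smalloD_tendsto)
  qed
  thus ?thesis by (simp add: tendsto_norm_zero_iff)
qed

lemma dougall_sum_step:
  assumes "Re (a + b + c + d) > 3"
  shows "(a + b + c + d - 3) * dougall_sum a b c d =
    (a + d - 1) * (b + d - 1) * dougall_sum a b c (d + 1)"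
proof -
  \<comment> \<open>With this choice \<open>G (n + 1)\<close> and \<open>G n\<close> are quadratics
    in n times one common factor. The n^2 terms of the difference cancel, and the linear rest is
    \<open>\<alpha> * (d - n) - \<beta>\<close>: its slope gives \<open>\<alpha>\<close>, its value
    at n = d gives \<open>\<beta>\<close>.\<close>
  define G where "G = dougall_term (a - 1) (b - 1) c (d + 1)"
  define \<alpha> where "\<alpha> = a + b + c + d - 3"
  define \<beta> where "\<beta> = (a + d - 1) * (b + d - 1)"
  have diff: "G (n + 1) - G n = \<alpha> * dougall_term a b c d n - \<beta> * dougall_term a b c (d + 1) n" for n
  proof -
    define n' :: complex where "n' = of_int n"
    have 1: "rGamma (a - 1 + n') = (a + n' - 1) * rGamma (a + n')"
      "rGamma (b - 1 + n') = (b + n' - 1) * rGamma (b + n')"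
      "rGamma (c - (n' + 1)) = (c - n' - 1) * rGamma (c - n')"
      "rGamma (d - n') = (d - n') * rGamma (d + 1 - n')"
      by (subst rGamma_rec, simp add: algebra_simps)+
    have 2: "a - 1 + (n' + 1) = a + n'" "b - 1 + (n' + 1) = b + n'" "d + 1 - (n' + 1) = d - n'"
      by simp_all
    show ?thesis
      unfolding G_def dougall_term_def of_int_add of_int_1 n'_def[symmetric] 1 2 \<alpha>_def \<beta>_def
      by Groebner_Basis.algebra
  qed
  have "((\<lambda>n. G (n + 1) - G n) has_sum 0) UNIV"
  proof (rule has_sum_telescope_UNIV)
    show "(\<lambda>x. G (x + 1) - G x) summable_on UNIV"
      unfolding diff by (subst diff_conv_add_uminus, intro summable_on_add summable_on_uminus[THEN iffD2] summable_on_cmult_right dougall_summable)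
         (use assms in simp_all)
    \<comment> \<open>The parameters of \<open>G\<close> add up to a + b + c + d - 1, so its growth
      exponent is 3 - Re (a + b + c + d) < 0.\<close>
    show "(\<lambda>n. G (int n)) \<longlonglongrightarrow> 0" "(\<lambda>n. G (- int n)) \<longlonglongrightarrow> 0"
      unfolding G_def
      by (rule bigo_powr_neg_imp_tendsto_0[OF dougall_term_bigo] 
               bigo_powr_neg_imp_tendsto_0[OF dougall_term_bigo'], use assms in simp)+
  qed
  moreover have "((\<lambda>n. G (n + 1) - G n) has_sum
      (\<alpha> * dougall_sum a b c d - \<beta> * dougall_sum a b c (d + 1))) UNIV"
    unfolding diff dougall_sum_def
    by (subst (1 2) diff_conv_add_uminus, intro has_sum_add has_sum_uminusI has_sum_cmult_right has_sum_infsum dougall_summable)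
       (use assms in simp_all)
  ultimately have "\<alpha> * dougall_sum a b c d - \<beta> * dougall_sum a b c (d + 1) = 0"
    using has_sum_unique by blast
  thus ?thesis by (simp add: \<alpha>_def \<beta>_def)
qed

lemma pos_Re_not_nonpos_Int: "Re z > 0 \<Longrightarrow> z \<notin> \<int>\<^sub>\<le>\<^sub>0"
  by (auto elim!: nonpos_Ints_cases)

lemma dougall_value_step:
  assumes "Re (a + b + c + d) > 3"
  shows "(a + b + c + d - 3) * dougall_value a b c d =
    (a + d - 1) * (b + d - 1) * dougall_value a b c (d + 1)"
proof -
  have "Gamma (a + b + c + (d + 1) - 3) = (a + b + c + d - 3) * Gamma (a + b + c + d - 3)"
    using Gamma_plus1[OF pos_Re_not_nonpos_Int, of "a + b + c + d - 3"] assms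
    by (simp add: algebra_simps)
  moreover have "rGamma (a + d - 1) = (a + d - 1) * rGamma (a + (d + 1) - 1)"
    "rGamma (b + d - 1) = (b + d - 1) * rGamma (b + (d + 1) - 1)"
    by (subst rGamma_rec, simp add: algebra_simps)+
  ultimately show ?thesis by (simp add: dougall_value_def)
qed

definition dougall_ratio :: "complex \<Rightarrow> complex \<Rightarrow> complex \<Rightarrow> complex \<Rightarrow> complex" where
  "dougall_ratio a b c d = dougall_sum a b c d / dougall_value a b c d"

text \<open>Together with \<open>dougall_reflect\<close> this generates a Klein four-group acting
  transitively on the four places, so a relation in the last parameter carries over to every other
  one.\<close>

lemma dougall_swap:
  "dougall_sum b a d c = dougall_sum a b c d" "dougall_value b a d c = dougall_value a b c d"
  "dougall_ratio b a d c = dougall_ratio a b c d"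
proof -
  show 1: "dougall_sum b a d c = dougall_sum a b c d"
    by (simp add: dougall_sum_def dougall_term_def[abs_def] mult_ac)
  show 2: "dougall_value b a d c = dougall_value a b c d"
    by (simp add: dougall_value_def algebra_simps)
  show "dougall_ratio b a d c = dougall_ratio a b c d"
    by (simp add: dougall_ratio_def 1 2)
qed

lemma dougall_reflect:
  "dougall_sum c d a b = dougall_sum a b c d" "dougall_value c d a b = dougall_value a b c d"
  "dougall_ratio c d a b = dougall_ratio a b c d"
proof -
  have "infsum (dougall_term c d a b) UNIV = infsum (dougall_term a b c d) UNIV"
    by (rule infsum_reindex_bij_witness[of _ uminus uminus])
       (auto simp: dougall_term_def mult_ac)
  thus 1: "dougall_sum c d a b = dougall_sum a b c d"
    by (simp add: dougall_sum_def)
  show 2: "dougall_value c d a b = dougall_value a b c d"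
    by (simp add: dougall_value_def algebra_simps)
  show "dougall_ratio c d a b = dougall_ratio a b c d"
    by (simp add: dougall_ratio_def 1 2)
qed

lemma dougall_value_nonzero:
  assumes "Re a \<ge> 1" "Re b \<ge> 1" "Re c \<ge> 1" "Re d \<ge> 1" "Re (a + b + c + d) > 4"
  shows "dougall_value a b c d \<noteq> 0"
proof -
  have "a + b + c + d - 3 \<notin> \<int>\<^sub>\<le>\<^sub>0" "a + c - 1 \<notin> \<int>\<^sub>\<le>\<^sub>0" "a + d - 1 \<notin> \<int>\<^sub>\<le>\<^sub>0"
    "b + c - 1 \<notin> \<int>\<^sub>\<le>\<^sub>0" "b + d - 1 \<notin> \<int>\<^sub>\<le>\<^sub>0"
    using assms by (intro pos_Re_not_nonpos_Int; simp)+
  thus ?thesis by (simp add: dougall_value_def rGamma_eq_zero_iff Gamma_eq_zero_iff)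
qed

lemma dougall_ratio_step:
  assumes "Re a \<ge> 1" "Re b \<ge> 1" "Re c \<ge> 1" "Re d \<ge> 1" "Re (a + b + c + d) > 4"
  shows "dougall_ratio a b c (d + 1) = dougall_ratio a b c d"
proof -
  have nz: "dougall_value a b c d \<noteq> 0" "dougall_value a b c (d + 1) \<noteq> 0"
    using assms by (intro dougall_value_nonzero; simp)+
  have "a + b + c + d - 3 \<noteq> 0"
    using assms(5) by (auto simp: complex_eq_iff)
  with nz dougall_value_step[of a b c d] assms have nz': "(a + d - 1) * (b + d - 1) \<noteq> 0"
    by auto
  define \<tau> where "\<tau> = (a + d - 1) * (b + d - 1)"
  have "\<tau> * (dougall_sum a b c (d + 1) * dougall_value a b c d)
      = (a + b + c + d - 3) * dougall_sum a b c d * dougall_value a b c d"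
    using dougall_sum_step[of a b c d] assms by (simp add: \<tau>_def)
  also have "\<dots> = dougall_sum a b c d * (\<tau> * dougall_value a b c (d + 1))"
    using dougall_value_step[of a b c d] assms by (simp add: \<tau>_def mult_ac)
  also have "\<dots> = \<tau> * (dougall_sum a b c d * dougall_value a b c (d + 1))"
    by (simp add: mult_ac)
  finally have "dougall_sum a b c (d + 1) * dougall_value a b c d
      = dougall_sum a b c d * dougall_value a b c (d + 1)"
    using nz' unfolding \<tau>_def mult_cancel_left by blast
  thus ?thesis using nz by (simp add: dougall_ratio_def frac_eq_eq)
qed

lemma dougall_ratio_shift:
  assumes "Re a \<ge> 2" "Re b \<ge> 2" "Re c \<ge> 2" "Re d \<ge> 2"
  shows "dougall_ratio (a + of_nat m) b c (d + of_nat m) = dougall_ratio a b c d"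
proof -
  have d: "dougall_ratio x y u (v + of_nat m) = dougall_ratio x y u v"
    if "Re x \<ge> 2" "Re y \<ge> 2" "Re u \<ge> 2" "Re v \<ge> 2" for x y u v and m :: nat
  proof (induction m)
    case (Suc m)
    have "dougall_ratio x y u (v + of_nat m + 1) = dougall_ratio x y u (v + of_nat m)"
      by (rule dougall_ratio_step) (use that in simp_all)
    with Suc show ?case by (simp add: algebra_simps)
  qed simp
  have "dougall_ratio (a + of_nat m) b c (d + of_nat m) = dougall_ratio (a + of_nat m) b c d"
    by (rule d) (use assms in simp_all)
  \<comment> \<open>Composing both symmetries reverses the parameters and so moves a to the last
    place, where the shift is known.\<close>
  also have "\<dots> = dougall_ratio d c b (a + of_nat m)"
    by (metis dougall_swap(3) dougall_reflect(3))
  also have "\<dots> = dougall_ratio d c b a"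
    by (rule d) (use assms in simp_all)
  also have "\<dots> = dougall_ratio a b c d"
    by (metis dougall_swap(3) dougall_reflect(3))
  finally show ?thesis .
qed

section \<open>The limit of large simultaneous shifts of a and d\<close>

lemma Gamma_ratio_asymptotics:
  fixes x y :: complex
  assumes "x \<notin> \<int>\<^sub>\<le>\<^sub>0"
  shows "(\<lambda>n::nat. Gamma (x + of_nat n) * rGamma (y + of_nat n) *
           exp ((y - x) * of_real (ln (real n)))) \<longlonglongrightarrow> 1"
proof -
  define E where "E = (\<lambda>x n. rGamma (x + of_nat n) * (fact n * exp ((x - 1) * complex_of_real (ln (real n)))))"
  have E: "E x \<longlonglongrightarrow> 1" for x
    unfolding E_def by (rule rGamma_plus_nat_asymptotics)
  have "(\<lambda>n. E y n / E x n) \<longlonglongrightarrow> 1 / 1"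
    by (intro tendsto_divide E) simp
  moreover have "E y n / E x n = Gamma (x + of_nat n) * rGamma (y + of_nat n) *
           exp ((y - x) * of_real (ln (real n)))" for n
  proof -
    have "exp ((y - x) * complex_of_real (ln (real n))) =
      exp ((y - 1) * of_real (ln (real n))) / exp ((x - 1) * of_real (ln (real n)))"
      by (simp add: exp_diff[symmetric] algebra_simps)
    thus ?thesis by (simp add: E_def Gamma_def divide_simps)
  qed
  ultimately show ?thesis by simp
qed

lemma rGamma_minus_nat_eq_prod:
  "rGamma (z - of_nat n) = (\<Prod>k<n. z - 1 - of_nat k) * rGamma z" for z :: complex
proof (induction n)
  case (Suc n)
  have "rGamma (z - of_nat (Suc n)) = (z - of_nat (Suc n)) * rGamma (z - of_nat n)"
    using rGamma_rec[of "z - of_nat (Suc n)"] by simp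
  with Suc show ?case by (simp add: algebra_simps)
qed simp

lemma rGamma_plus_nat_eq_prod:
  assumes "Re z > 0"
  shows "rGamma (z + of_nat n) = rGamma z / (\<Prod>k<n. z + of_nat k)"
proof -
  have "pochhammer z n \<noteq> 0"
    using assms pochhammer_eq_0_imp_nonpos_Int pos_Re_not_nonpos_Int by blast
  thus ?thesis
    using pochhammer_rGamma[of z n] by (simp add: pochhammer_prod atLeast0LessThan field_simps)
qed

text \<open>The part of the shifted summand that involves a and d, normalised to be 1 at n = 0 away
  from poles. For fixed n it tends to 1 as m grows.\<close>

definition gamma_weight :: "complex \<Rightarrow> complex \<Rightarrow> nat \<Rightarrow> int \<Rightarrow> complex" where
  "gamma_weight a d m n = Gamma (a + of_nat m) * Gamma (d + of_nat m) *
     (rGamma (a + of_nat m + of_int n) * rGamma (d + of_nat m - of_int n))"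

lemma gamma_weight_reflect: "gamma_weight d a m n = gamma_weight a d m (- n)"
  by (simp add: gamma_weight_def mult_ac)

text \<open>A product of n explicit fractions yields both the limit, as each fraction tends to 1 in
  m, and a bound uniform in m and n.\<close>

lemma gamma_weight_eq_prod:
  assumes "Re a > 0" "Re d > 0"
  shows "gamma_weight a d m (int n) =
    (\<Prod>k<n. (d + of_nat m - 1 - of_nat k) / (a + of_nat m + of_nat k))"
proof -
  have "a + of_nat m \<notin> \<int>\<^sub>\<le>\<^sub>0" "d + of_nat m \<notin> \<int>\<^sub>\<le>\<^sub>0"
    using assms by (intro pos_Re_not_nonpos_Int; simp)+
  hence "Gamma (a + of_nat m) * rGamma (a + of_nat m) = 1" "Gamma (d + of_nat m) * rGamma (d + of_nat m) = 1"
    by (simp_all add: rGamma_inverse_Gamma Gamma_eq_zero_iff)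
  moreover have "rGamma (a + of_nat m + of_nat n) = rGamma (a + of_nat m) / (\<Prod>k<n. a + of_nat m + of_nat k)"
    by (rule rGamma_plus_nat_eq_prod) (use assms in simp)
  ultimately show ?thesis
    by (simp add: gamma_weight_def rGamma_minus_nat_eq_prod prod_dividef) Groebner_Basis.algebra
qed

lemma gamma_weight_tendsto:
  assumes "Re a > 0" "Re d > 0"
  shows "(\<lambda>m. gamma_weight a d m n) \<longlonglongrightarrow> 1"
proof -
  have nat: "(\<lambda>m. gamma_weight a d m (int n)) \<longlonglongrightarrow> 1" if "Re a > 0" "Re d > 0" for a d n
  proof -
    have "(\<lambda>m. (d + of_nat m - 1 - of_nat k) / (a + of_nat m + of_nat k)) \<longlonglongrightarrow> 1" for k
    proof (rule Lim_transform_eventually)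
      have "(\<lambda>m. ((d - 1 - of_nat k) / of_nat m + 1) / ((a + of_nat k) / of_nat m + 1)) \<longlonglongrightarrow> (0 + 1) / (0 + 1)"
        by (intro tendsto_intros lim_const_over_n) simp
      thus "(\<lambda>m. ((d - 1 - of_nat k) / of_nat m + 1) / ((a + of_nat k) / of_nat m + 1)) \<longlonglongrightarrow> 1"
        by simp
      show "\<forall>\<^sub>F m in sequentially. ((d - 1 - of_nat k) / of_nat m + 1) / ((a + of_nat k) / of_nat m + 1)
          = (d + of_nat m - 1 - of_nat k) / (a + of_nat m + of_nat k)"
        using eventually_gt_at_top[of 0]
      proof eventually_elim
        case (elim m)
        have "((d - 1 - of_nat k) / of_nat m + 1) = (d + of_nat m - 1 - of_nat k) / of_nat m"
          "((a + of_nat k) / of_nat m + 1) = (a + of_nat m + of_nat k) / of_nat m"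
          using elim by (simp_all add: field_simps)
        thus ?case using elim by simp
      qed
    qed
    hence "(\<lambda>m. \<Prod>k<n. (d + of_nat m - 1 - of_nat k) / (a + of_nat m + of_nat k)) \<longlonglongrightarrow> (\<Prod>k<n. 1)"
      by (intro tendsto_prod)
    thus ?thesis
      unfolding gamma_weight_eq_prod[OF that] by simp
  qed
  show ?thesis
  proof (cases "n \<ge> 0")
    case True
    with nat[OF assms, of "nat n"] show ?thesis by simp
  next
    case False
    with nat[OF assms(2,1), of "nat (- n)"] show ?thesis by (simp add: gamma_weight_reflect[of d a])
  qed
qed

text \<open>In each fraction of \<open>gamma_weight_eq_prod\<close> the real part of the numerator
  is at most that of the denominator in modulus, since Re d - 1 <= Re a and Re d >= 1. The imaginary
  part costs at most a factor exp ((Im d)^2 / (k + 1)^2), and the product of these over k converges.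
  Negative n exchanges a and d, hence the symmetric condition.\<close>

lemma gamma_weight_bounded:
  assumes "Re a \<ge> 1" "Re d \<ge> 1" "\<bar>Re a - Re d\<bar> \<le> 1"
  shows "\<exists>C. \<forall>m n. norm (gamma_weight a d m n) \<le> C"
proof -
  define s where "s = (\<Sum>k. 1 / real (Suc k) ^ 2)"
  have summ: "summable (\<lambda>k. 1 / real (Suc k) ^ 2)"
    using inverse_squares_sums by (simp add: sums_iff add_ac)
  have nat: "norm (gamma_weight a d m (int n)) \<le> exp ((Im d)\<^sup>2 * s)"
    if ad: "Re a \<ge> 1" "Re d \<ge> 1" "\<bar>Re a - Re d\<bar> \<le> 1" for a d m n
  proof -
    have fac: "norm ((d + of_nat m - 1 - of_nat k) / (a + of_nat m + of_nat k))
        \<le> exp ((Im d)\<^sup>2 * (1 / real (Suc k) ^ 2))" (is "?l \<le> _") for k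
    proof -
      define A where "A = Re a + real m + real k"
      have A: "A \<ge> real (Suc k)" using ad by (simp add: A_def)
      hence A0: "A > 0" by (simp add: A_def)
      have "norm (d + of_nat m - 1 - of_nat k) ^ 2 = (Re d + real m - 1 - real k)\<^sup>2 + (Im d)\<^sup>2"
        by (simp add: cmod_power2)
      also have "\<dots> \<le> A\<^sup>2 + (Im d)\<^sup>2"
        by (rule add_right_mono, rule abs_le_square_iff[THEN iffD1]) (use ad in \<open>auto simp: A_def\<close>)
      also have "A\<^sup>2 + (Im d)\<^sup>2 = A\<^sup>2 * (1 + (Im d)\<^sup>2 * (1 / A\<^sup>2))"
        using A0 by (simp add: field_simps)
      also have "\<dots> \<le> A\<^sup>2 * (1 + (Im d)\<^sup>2 * (1 / real (Suc k) ^ 2))"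
        using A by (intro mult_left_mono add_left_mono divide_left_mono power_mono) auto
      also have "\<dots> \<le> A\<^sup>2 * exp ((Im d)\<^sup>2 * (1 / real (Suc k) ^ 2))"
        by (intro mult_left_mono exp_ge_add_one_self) simp
      \<comment> \<open>The exponential is at least 1; squaring it makes the right side a perfect
        square, so that the root can be taken.\<close>
      also have "\<dots> \<le> A\<^sup>2 * (exp ((Im d)\<^sup>2 * (1 / real (Suc k) ^ 2)))\<^sup>2"
        by (intro mult_left_mono self_le_power) auto
      also have "\<dots> = (A * exp ((Im d)\<^sup>2 * (1 / real (Suc k) ^ 2)))\<^sup>2"
        by (simp add: power_mult_distrib)
      finally have "norm (d + of_nat m - 1 - of_nat k) \<le> A * exp ((Im d)\<^sup>2 * (1 / real (Suc k) ^ 2))"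
        by (rule power2_le_imp_le) (intro mult_nonneg_nonneg less_imp_le[OF A0] exp_ge_zero)
      also have "\<dots> \<le> norm (a + of_nat m + of_nat k) * exp ((Im d)\<^sup>2 * (1 / real (Suc k) ^ 2))"
        using complex_Re_le_cmod[of "a + of_nat m + of_nat k"] by (simp add: A_def)
      finally have "norm (d + of_nat m - 1 - of_nat k)
        \<le> norm (a + of_nat m + of_nat k) * exp ((Im d)\<^sup>2 * (1 / real (Suc k) ^ 2))" .
      moreover have "norm (a + of_nat m + of_nat k) > 0"
        using less_le_trans[OF A0, of "norm (a + of_nat m + of_nat k)"]
          complex_Re_le_cmod[of "a + of_nat m + of_nat k"] by (simp only: A_def) simp
      ultimately show ?thesis
        unfolding norm_divide by (subst pos_divide_le_eq) (simp_all only: mult.commute)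
    qed
    have "norm (gamma_weight a d m (int n))
        = (\<Prod>k<n. norm ((d + of_nat m - 1 - of_nat k) / (a + of_nat m + of_nat k)))"
      using ad by (subst gamma_weight_eq_prod) (simp_all add: prod_norm)
    also have "\<dots> \<le> (\<Prod>k<n. exp ((Im d)\<^sup>2 * (1 / real (Suc k) ^ 2)))"
      by (intro prod_mono conjI norm_ge_zero fac)
    also have "\<dots> = exp ((Im d)\<^sup>2 * (\<Sum>k<n. 1 / real (Suc k) ^ 2))"
      by (simp add: exp_sum sum_distrib_left)
    also have "\<dots> \<le> exp ((Im d)\<^sup>2 * s)"
      unfolding s_def using sum_le_suminf[OF summ, of "{..<n}"] by (simp add: mult_left_mono)
    finally show ?thesis .
  qed
  have "norm (gamma_weight a d m n) \<le> max (exp ((Im d)\<^sup>2 * s)) (exp ((Im a)\<^sup>2 * s))" for m n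
  proof (cases "n \<ge> 0")
    case True
    with nat[OF assms, of m "nat n"] show ?thesis by simp
  next
    case False
    with nat[of d a m "nat (- n)"] assms show ?thesis
      by (simp add: gamma_weight_reflect[of d a] abs_minus_commute)
  qed
  thus ?thesis by blast
qed

text \<open>After normalisation each summand is \<open>gamma_weight\<close> times a term free of m,
  so dominated convergence applies; Re (b + c) > 2 makes these terms summable.\<close>

lemma gamma_weighted_dougall_sum_tendsto:
  assumes "Re a \<ge> 1" "Re d \<ge> 1" "\<bar>Re a - Re d\<bar> \<le> 1" "Re (b + c) > 2"
  shows "(\<lambda>m. Gamma (a + of_nat m) * Gamma (d + of_nat m) * dougall_sum (a + of_nat m) b c (d + of_nat m))
     \<longlonglongrightarrow> (\<Sum>\<^sub>\<infinity>n\<in>UNIV. rGamma (b + of_int n) * rGamma (c - of_int n))"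
proof -
  define u where "u = (\<lambda>n. rGamma (b + of_int n) * rGamma (c - of_int n))"
  obtain C where C: "\<And>m n. norm (gamma_weight a d m n) \<le> C"
    using gamma_weight_bounded[OF assms(1-3)] by blast
  have u: "u summable_on UNIV"
  proof (rule bigo_powr_imp_summable_on_int)
    show "(\<lambda>n. norm (u (int n))) \<in> O(\<lambda>n. real n powr (1 - Re b - Re c))"
      using rGamma_pair_bigo[of b c] by (simp add: u_def)
    show "(\<lambda>n. norm (u (- int n))) \<in> O(\<lambda>n. real n powr (1 - Re b - Re c))"
      using rGamma_pair_bigo[of c b] by (simp add: u_def mult.commute diff_diff_eq add.commute[of "Re c"])
  qed (use assms in simp)
  have "(\<lambda>m. \<Sum>\<^sub>\<infinity>n\<in>UNIV. gamma_weight a d m n * u n) \<longlonglongrightarrow> infsum u UNIV"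
  proof (rule infsum_dominated_tendsto_int)
    show "(\<lambda>m. gamma_weight a d m n * u n) \<longlonglongrightarrow> u n" for n
    proof -
      have "(\<lambda>m. gamma_weight a d m n * u n) \<longlonglongrightarrow> 1 * u n"
        by (intro tendsto_mult tendsto_const gamma_weight_tendsto) (use assms in simp_all)
      thus ?thesis by simp
    qed
    show "norm (gamma_weight a d m n * u n) \<le> C * norm (u n)" for m n
      unfolding norm_mult by (intro mult_right_mono C) simp
    show "(\<lambda>n. C * norm (u n)) summable_on UNIV"
      using u by (intro summable_on_cmult_right) (simp add: summable_on_iff_abs_summable_on_complex)
  qed
  moreover have "(\<Sum>\<^sub>\<infinity>n\<in>UNIV. gamma_weight a d m n * u n) = Gamma (a + of_nat m) * Gamma (d + of_nat m) *
      dougall_sum (a + of_nat m) b c (d + of_nat m)" for m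
    unfolding dougall_sum_def
    by (subst infsum_cmult_right'[symmetric], intro infsum_cong)
       (simp add: gamma_weight_def u_def dougall_term_def mult_ac)
  ultimately show ?thesis by (simp add: u_def)
qed

text \<open>Shifting a and d together moves a + d and a + b + c + d by 2m. The three Gamma quotients
  behave like (2m)^(b + c - 2), m^(1 - c) and m^(1 - b), so the powers of m cancel and 2^(b + c - 2)
  remains.\<close>

lemma gamma_weighted_dougall_value_tendsto:
  assumes "Re a \<ge> 1" "Re b \<ge> 1" "Re c \<ge> 1" "Re d \<ge> 1"
  shows "(\<lambda>m. Gamma (a + of_nat m) * Gamma (d + of_nat m) * dougall_value (a + of_nat m) b c (d + of_nat m))
     \<longlonglongrightarrow> exp ((b + c - 2) * of_real (ln 2)) * rGamma (b + c - 1)"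
proof -
  define x where "x = a + b + c + d - 3"
  define y where "y = a + d - 1"
  define A where "A = (\<lambda>n::nat. Gamma (x + of_nat n) * rGamma (y + of_nat n) * exp ((y - x) * of_real (ln (real n))))"
  define B where "B = (\<lambda>n::nat. Gamma (a + of_nat n) * rGamma (a + c - 1 + of_nat n) * exp ((a + c - 1 - a) * of_real (ln (real n))))"
  define D where "D = (\<lambda>n::nat. Gamma (d + of_nat n) * rGamma (b + d - 1 + of_nat n) * exp ((b + d - 1 - d) * of_real (ln (real n))))"
  have np: "x \<notin> \<int>\<^sub>\<le>\<^sub>0" "a \<notin> \<int>\<^sub>\<le>\<^sub>0" "d \<notin> \<int>\<^sub>\<le>\<^sub>0"
    using assms unfolding x_def by (intro pos_Re_not_nonpos_Int; simp)+
  have "filterlim (\<lambda>m::nat. 2 * m) sequentially sequentially"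
    by (rule filterlim_subseq) (simp add: strict_mono_def)
  hence A2: "(\<lambda>m. A (2 * m)) \<longlonglongrightarrow> 1"
    by (rule filterlim_compose[rotated]) (unfold A_def, rule Gamma_ratio_asymptotics[OF np(1)])
  have "(\<lambda>m. A (2 * m) * B m * D m * exp ((b + c - 2) * of_real (ln 2)) * rGamma (b + c - 1))
    \<longlonglongrightarrow> 1 * 1 * 1 * exp ((b + c - 2) * of_real (ln 2)) * rGamma (b + c - 1)"
    unfolding B_def D_def
    by (intro tendsto_mult tendsto_const A2 Gamma_ratio_asymptotics np)
  hence "(\<lambda>m. A (2 * m) * B m * D m * exp ((b + c - 2) * of_real (ln 2)) * rGamma (b + c - 1))
    \<longlonglongrightarrow> exp ((b + c - 2) * of_real (ln 2)) * rGamma (b + c - 1)" by simp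
  thus ?thesis
  proof (rule Lim_transform_eventually)
    show "\<forall>\<^sub>F m in sequentially. A (2 * m) * B m * D m * exp ((b + c - 2) * of_real (ln 2)) * rGamma (b + c - 1)
      = Gamma (a + of_nat m) * Gamma (d + of_nat m) * dougall_value (a + of_nat m) b c (d + of_nat m)"
      using eventually_gt_at_top[of 0]
    proof eventually_elim
      case (elim m)
      define L where "L = complex_of_real (ln (real m))"
      have ln2: "complex_of_real (ln (real (2 * m))) = of_real (ln 2) + L"
        using elim by (simp add: ln_mult L_def)
      have e: "exp ((y - x) * of_real (ln (real (2 * m)))) * exp ((a + c - 1 - a) * L) *
          exp ((b + d - 1 - d) * L) * exp ((b + c - 2) * of_real (ln 2)) = 1"
        unfolding ln2 exp_add[symmetric] exp_eq_1 by (simp add: x_def y_def algebra_simps)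
      have args: "a + of_nat m + b + c + (d + of_nat m) - 3 = x + of_nat (2 * m)"
        "a + of_nat m + (d + of_nat m) - 1 = y + of_nat (2 * m)"
        "a + of_nat m + c - 1 = a + c - 1 + of_nat m" "b + (d + of_nat m) - 1 = b + d - 1 + of_nat m"
        by (simp_all add: x_def y_def)
      show ?case
        unfolding dougall_value_def args A_def B_def D_def L_def[symmetric]
        using e by Groebner_Basis.algebra
    qed
  qed
qed

text \<open>The shifts leave the ratio unchanged, so it equals its limit, whose formula contains
  neither a nor d.\<close>

lemma dougall_ratio_eq_limit:
  assumes "Re a \<ge> 2" "Re b \<ge> 2" "Re c \<ge> 2" "Re d \<ge> 2" "\<bar>Re a - Re d\<bar> \<le> 1"
  shows "dougall_ratio a b c d = (\<Sum>\<^sub>\<infinity>n\<in>UNIV. rGamma (b + of_int n) * rGamma (c - of_int n)) /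
     (exp ((b + c - 2) * of_real (ln 2)) * rGamma (b + c - 1))" (is "_ = ?S / ?V")
proof -
  have "b + c - 1 \<notin> \<int>\<^sub>\<le>\<^sub>0"
    using assms by (intro pos_Re_not_nonpos_Int) simp
  hence V: "?V \<noteq> 0" by (simp add: rGamma_eq_zero_iff)
  have "(\<lambda>m. (Gamma (a + of_nat m) * Gamma (d + of_nat m) * dougall_sum (a + of_nat m) b c (d + of_nat m)) /
     (Gamma (a + of_nat m) * Gamma (d + of_nat m) * dougall_value (a + of_nat m) b c (d + of_nat m))) \<longlonglongrightarrow> ?S / ?V"
    by (intro tendsto_divide gamma_weighted_dougall_sum_tendsto gamma_weighted_dougall_value_tendsto)
       (use assms V in simp_all)
  moreover have "(Gamma (a + of_nat m) * Gamma (d + of_nat m) * dougall_sum (a + of_nat m) b c (d + of_nat m)) /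
     (Gamma (a + of_nat m) * Gamma (d + of_nat m) * dougall_value (a + of_nat m) b c (d + of_nat m))
     = dougall_ratio a b c d" for m
  proof -
    have "a + of_nat m \<notin> \<int>\<^sub>\<le>\<^sub>0" "d + of_nat m \<notin> \<int>\<^sub>\<le>\<^sub>0"
      using assms by (intro pos_Re_not_nonpos_Int; simp)+
    thus ?thesis
      using dougall_ratio_shift[of a b c d m] assms by (simp add: dougall_ratio_def Gamma_eq_zero_iff)
  qed
  ultimately have "(\<lambda>m::nat. dougall_ratio a b c d) \<longlonglongrightarrow> ?S / ?V" by simp
  thus ?thesis by (simp add: LIMSEQ_const_iff)
qed

text \<open>Only n = -1, 0, 1 survive: the sum is 1/4 + 1 + 1/4 and the closed form is
  24/16.\<close>

lemma dougall_ratio_2: "dougall_ratio 2 2 2 2 = 1"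
proof -
  have zero: "dougall_term 2 2 2 2 n = 0" if "n \<notin> {-1, 0, 1}" for n
  proof (cases "n > 0")
    case True
    with that have "rGamma (of_int (2 - n)) = (0::complex)" by (simp only: rGamma_of_int) auto
    thus ?thesis by (simp add: dougall_term_def)
  next
    case False
    with that have "rGamma (of_int (2 + n)) = (0::complex)" by (simp only: rGamma_of_int) auto
    thus ?thesis by (simp add: dougall_term_def)
  qed
  have r: "rGamma 2 = (1::complex)" "rGamma 3 = (1/2::complex)"
    using rGamma_of_int[of 2, where 'a = complex] rGamma_of_int[of 3, where 'a = complex]
    by (simp_all add: fact_numeral)
  have g: "Gamma 5 = (24::complex)"
    using Gamma_fact[of 4, where 'a = complex] by (simp add: fact_numeral)
  have "dougall_sum 2 2 2 2 = (\<Sum>n\<in>{-1, 0, 1}. dougall_term 2 2 2 2 n)"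
    unfolding dougall_sum_def infsum_finite[symmetric, OF finite.insertI[OF finite.insertI[OF finite.insertI[OF finite.emptyI]]]]
    by (rule infsum_cong_neutral) (use zero in auto)
  thus ?thesis
    by (simp add: dougall_ratio_def dougall_value_def dougall_term_def r g)
qed

theorem dougall_bilateral_sum:
  assumes "Re (a + b + c + d) > 3"
  shows "(dougall_term a b c d has_sum dougall_value a b c d) UNIV"
proof -
  \<comment> \<open>Equality rather than the ratio is carried downwards, because the closed form may
    vanish at small parameters. Each step of the descent divides by the sum of the current
    parameters minus 3, which has positive real part.\<close>
  define P where "P a b c d \<longleftrightarrow> dougall_sum a b c d = dougall_value a b c d" for a b c d
  have step: "P a b c (d + of_nat k) \<Longrightarrow> P a b c d" if "Re (a + b + c + d) > 3" for a b c d k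
  proof (induction k)
    case (Suc k)
    have *: "Re (a + b + c + (d + of_nat k)) > 3" using that by simp
    hence "a + b + c + (d + of_nat k) - 3 \<noteq> 0" by (auto simp: complex_eq_iff)
    moreover have "P a b c (d + of_nat k + 1)" using Suc.prems by (simp add: algebra_simps)
    ultimately have "P a b c (d + of_nat k)"
      using dougall_sum_step[OF *] dougall_value_step[OF *] unfolding P_def
      by (metis mult_left_cancel)
    thus ?case by (rule Suc.IH)
  qed simp
  have perm: "P b a d c \<longleftrightarrow> P a b c d" "P c d a b \<longleftrightarrow> P a b c d" for a b c d
    by (simp_all add: P_def dougall_swap dougall_reflect)
  \<comment> \<open>All parameters are raised until their real parts lie in [R, R + 1]; this gives
    the distance at most 1 that \<open>dougall_ratio_eq_limit\<close> asks for.\<close>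
  define R where "R = Max {2, \<lceil>Re a\<rceil>, \<lceil>Re b\<rceil>, \<lceil>Re c\<rceil>, \<lceil>Re d\<rceil>}"
  have R: "R \<ge> 2" by (simp add: R_def)
  have shift: "\<exists>k. of_int R \<le> Re x + real k \<and> Re x + real k \<le> of_int R + 1" if "Re x \<le> of_int R" for x
    by (rule exI[of _ "nat \<lceil>of_int R - Re x\<rceil>"]) (use that in linarith)
  have le: "Re a \<le> of_int R" "Re b \<le> of_int R" "Re c \<le> of_int R" "Re d \<le> of_int R"
    by (simp_all add: R_def ceiling_le_iff[symmetric])
  obtain i where i: "of_int R \<le> Re a + real i" "Re a + real i \<le> of_int R + 1" using shift[OF le(1)] by blast
  obtain j where j: "of_int R \<le> Re b + real j" "Re b + real j \<le> of_int R + 1" using shift[OF le(2)] by blast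
  obtain k where k: "of_int R \<le> Re c + real k" "Re c + real k \<le> of_int R + 1" using shift[OF le(3)] by blast
  obtain l where l: "of_int R \<le> Re d + real l" "Re d + real l \<le> of_int R + 1" using shift[OF le(4)] by blast
  define a' b' c' d' where "a' = a + of_nat i" and "b' = b + of_nat j" and "c' = c + of_nat k" and "d' = d + of_nat l"
  have ge: "Re a' \<ge> 2" "Re b' \<ge> 2" "Re c' \<ge> 2" "Re d' \<ge> 2" "\<bar>Re a' - Re d'\<bar> \<le> 1" "\<bar>Re b' - Re c'\<bar> \<le> 1"
    using R i j k l by (auto simp: a'_def b'_def c'_def d'_def)
  \<comment> \<open>First the outer parameters are replaced by 2; swapping then brings b' and c' to
    the outer places, where they are replaced too.\<close>
  have "dougall_ratio a' b' c' d' = dougall_ratio 2 b' c' 2"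
    using ge by (simp add: dougall_ratio_eq_limit)
  also have "\<dots> = dougall_ratio b' 2 2 c'"
    by (rule dougall_swap(3)[symmetric])
  also have "\<dots> = dougall_ratio 2 2 2 2"
    using ge by (simp add: dougall_ratio_eq_limit)
  finally have "dougall_ratio a' b' c' d' = 1"
    by (simp add: dougall_ratio_2)
  \<comment> \<open>A ratio of 1 forces a nonzero denominator, since division by 0 yields 0.\<close>
  hence "P a' b' c' d'"
    by (simp add: P_def dougall_ratio_def divide_eq_1_iff)
  hence "P a' b' c' d" unfolding d'_def by (rule step[rotated]) (use ge assms i j k in \<open>simp add: a'_def b'_def c'_def\<close>)
  hence "P b' a' d c'" by (simp add: perm)
  hence "P b' a' d c" unfolding c'_def by (rule step[rotated]) (use ge i j le assms in \<open>simp add: a'_def b'_def\<close>)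
  hence "P d c b' a'" by (simp add: perm)
  hence "P d c b' a" unfolding a'_def by (rule step[rotated]) (use assms in \<open>simp add: b'_def\<close>)
  hence "P c d a b'" by (simp add: perm)
  hence "P c d a b" unfolding b'_def by (rule step[rotated]) (use assms in simp)
  hence "P a b c d" by (simp add: perm)
  thus ?thesis
    using has_sum_infsum[OF dougall_summable[OF assms, of UNIV]] by (simp add: P_def dougall_sum_def)
qed

subsection \<open>Vandermonde determinants on interlacing sequences\<close>

definition vandermonde_prod :: "nat \<Rightarrow> (nat \<Rightarrow> 'a) \<Rightarrow> 'a :: comm_ring_1" where
  "vandermonde_prod n x = (\<Prod>i<n. \<Prod>k<i. x i - x k)"

lemma det_eq_sum_permutations:
  "Determinant.det (Matrix.mat n n (\<lambda>(i, j). f i j)) =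
     (\<Sum>p | p permutes {0..<n}. signof p * (\<Prod>i<n. f i (p i)))"
proof -
  have "Determinant.det (Matrix.mat n n (\<lambda>(i, j). f i j)) = (\<Sum>p | p permutes {0..<n}. signof p *
      (\<Prod>i = 0..<n. Matrix.mat n n (\<lambda>(i, j). f i j) $$ (i, p i)))"
    by (subst det_def'[of _ n]) simp_all
  also have "\<dots> = (\<Sum>p | p permutes {0..<n}. signof p * (\<Prod>i<n. f i (p i)))"
    by (intro sum.cong refl arg_cong2[where f = times] prod.cong)
       (use permutes_in_image in \<open>fastforce simp: atLeast0LessThan\<close>)+
  finally show ?thesis .
qed

lemma det_lower_triangular_prod:
  fixes f :: "nat \<Rightarrow> nat \<Rightarrow> 'a :: idom"
  assumes "\<And>i j. i < j \<Longrightarrow> j < n \<Longrightarrow> f i j = 0"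
  shows "Determinant.det (Matrix.mat n n (\<lambda>(i, j). f i j)) = (\<Prod>i<n. f i i)"
proof -
  have "Determinant.det (Matrix.mat n n (\<lambda>(i, j). f i j)) = prod_list (diag_mat (Matrix.mat n n (\<lambda>(i, j). f i j)))"
    by (rule det_lower_triangular[of n]) (use assms in auto)
  also have "\<dots> = (\<Prod>i = 0..<n. f i i)"
    unfolding prod_list_diag_prod by (intro prod.cong) auto
  finally show ?thesis by (simp add: atLeast0LessThan)
qed

lemma det_upper_triangular_prod:
  fixes f :: "nat \<Rightarrow> nat \<Rightarrow> 'a :: idom"
  assumes "\<And>i j. j < i \<Longrightarrow> i < n \<Longrightarrow> f i j = 0"
  shows "Determinant.det (Matrix.mat n n (\<lambda>(i, j). f i j)) = (\<Prod>i<n. f i i)"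
proof -
  have "Determinant.det (Matrix.mat n n (\<lambda>(i, j). f i j)) = prod_list (diag_mat (Matrix.mat n n (\<lambda>(i, j). f i j)))"
    by (rule det_upper_triangular[of _ n]) (use assms in auto)
  also have "\<dots> = (\<Prod>i = 0..<n. f i i)"
    unfolding prod_list_diag_prod by (intro prod.cong) auto
  finally show ?thesis by (simp add: atLeast0LessThan)
qed

lemma det_mat_mult:
  fixes f g :: "nat \<Rightarrow> nat \<Rightarrow> 'a :: comm_ring_1"
  shows "Determinant.det (Matrix.mat n n (\<lambda>(i, j). \<Sum>k<n. f i k * g k j)) =
    Determinant.det (Matrix.mat n n (\<lambda>(i, j). f i j)) * Determinant.det (Matrix.mat n n (\<lambda>(i, j). g i j))"
proof -
  have "Matrix.mat n n (\<lambda>(i, j). \<Sum>k<n. f i k * g k j) =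
      Matrix.mat n n (\<lambda>(i, j). f i j) * Matrix.mat n n (\<lambda>(i, j). g i j)"
    by (rule eq_matI) (simp_all add: scalar_prod_def atLeast0LessThan)
  thus ?thesis by (simp add: Determinant.det_mult[of _ n])
qed

text \<open>Expanding each \<open>p j\<close> in monomials factors the matrix into the matrix of
  powers and an upper triangular coefficient matrix.\<close>

lemma det_poly_eval_monom:
  fixes p :: "nat \<Rightarrow> 'a :: idom poly"
  assumes "\<And>j. j < n \<Longrightarrow> degree (p j) \<le> j"
  shows "Determinant.det (Matrix.mat n n (\<lambda>(i, j). poly (p j) (x i))) =
    Determinant.det (Matrix.mat n n (\<lambda>(i, j). x i ^ j)) * (\<Prod>j<n. coeff (p j) j)"
proof -
  have "poly (p j) (x i) = (\<Sum>k<n. x i ^ k * coeff (p j) k)" if "j < n" for i j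
  proof -
    have "poly (p j) (x i) = (\<Sum>k\<le>degree (p j). coeff (p j) k * x i ^ k)"
      by (rule poly_altdef)
    also have "\<dots> = (\<Sum>k<n. coeff (p j) k * x i ^ k)"
      using assms[OF that] that by (intro sum.mono_neutral_left) (auto simp: coeff_eq_0)
    finally show ?thesis by (simp add: mult.commute)
  qed
  hence "Matrix.mat n n (\<lambda>(i, j). poly (p j) (x i)) = Matrix.mat n n (\<lambda>(i, j). \<Sum>k<n. x i ^ k * coeff (p j) k)"
    by (intro eq_matI) auto
  moreover have "Determinant.det (Matrix.mat n n (\<lambda>(k, j). coeff (p j) k)) = (\<Prod>j<n. coeff (p j) j)"
    by (rule det_upper_triangular_prod) (use assms in \<open>meson coeff_eq_0 le_less_trans less_trans\<close>)
  ultimately show ?thesis by (simp add: det_mat_mult)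
qed

text \<open>The Newton basis \<open>\<Prod>k<j. X - x k\<close> makes the evaluation matrix triangular.\<close>

lemma det_vandermonde:
  fixes x :: "nat \<Rightarrow> 'a :: idom"
  shows "Determinant.det (Matrix.mat n n (\<lambda>(i, j). x i ^ j)) = vandermonde_prod n x"
proof -
  define p where "p = (\<lambda>j. \<Prod>k<j. [:- x k, 1:])"
  have deg: "degree (p j) = j" for j
    unfolding p_def by (subst degree_prod_eq_sum_degree) auto
  have "lead_coeff (p j) = 1" for j
    unfolding p_def lead_coeff_prod by simp
  hence co: "coeff (p j) j = 1" for j by (simp add: deg)
  have "poly (p j) (x i) = 0" if "i < j" for i j
    using that by (auto simp: p_def poly_prod)
  hence "Determinant.det (Matrix.mat n n (\<lambda>(i, j). poly (p j) (x i))) = (\<Prod>i<n. poly (p i) (x i))"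
    by (intro det_lower_triangular_prod)
  moreover have "poly (p i) (x i) = (\<Prod>k<i. x i - x k)" for i
    by (simp add: p_def poly_prod)
  ultimately show ?thesis
    using det_poly_eval_monom[of n p x] by (simp add: deg co vandermonde_prod_def)
qed

lemma det_poly_eval:
  fixes p :: "nat \<Rightarrow> 'a :: idom poly"
  assumes "\<And>j. j < n \<Longrightarrow> degree (p j) \<le> j"
  shows "Determinant.det (Matrix.mat n n (\<lambda>(i, j). poly (p j) (x i))) =
    vandermonde_prod n x * (\<Prod>j<n. coeff (p j) j)"
  by (simp add: det_poly_eval_monom[OF assms] det_vandermonde)

lemma det_scale_rows:
  fixes f :: "nat \<Rightarrow> nat \<Rightarrow> 'a :: comm_ring_1"
  shows "Determinant.det (Matrix.mat n n (\<lambda>(i, j). c i * f i j)) =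
    (\<Prod>i<n. c i) * Determinant.det (Matrix.mat n n (\<lambda>(i, j). f i j))"
  by (simp add: det_eq_sum_permutations prod.distrib sum_distrib_left mult_ac)

text \<open>Taking partial sums of rows is left multiplication by the lower triangular matrix of
  ones, of determinant 1.\<close>

lemma det_partial_row_sums:
  fixes f :: "nat \<Rightarrow> nat \<Rightarrow> 'a :: idom"
  shows "Determinant.det (Matrix.mat n n (\<lambda>(i, j). \<Sum>k\<le>i. f k j)) =
    Determinant.det (Matrix.mat n n (\<lambda>(i, j). f i j))"
proof -
  have "(\<Sum>k\<le>i. f k j) = (\<Sum>k<n. (if k \<le> i then 1 else 0) * f k j)" if "i < n" for i j
    using that by (intro sum.mono_neutral_cong_left) auto
  hence "Matrix.mat n n (\<lambda>(i, j). \<Sum>k\<le>i. f k j) =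
      Matrix.mat n n (\<lambda>(i, j). \<Sum>k<n. (if k \<le> i then 1 else 0) * f k j)"
    by (intro eq_matI) auto
  moreover have "Determinant.det (Matrix.mat n n (\<lambda>(i, k). if k \<le> i then 1 else 0 :: 'a)) = 1"
    by (subst det_lower_triangular_prod) auto
  ultimately show ?thesis by (simp add: det_mat_mult)
qed

lemma det_last_row:
  fixes f :: "nat \<Rightarrow> nat \<Rightarrow> 'a :: comm_ring_1"
  assumes "\<And>j. 0 < j \<Longrightarrow> j \<le> m \<Longrightarrow> f m j = 0"
  shows "Determinant.det (Matrix.mat (Suc m) (Suc m) (\<lambda>(i, j). f i j)) =
    (-1) ^ m * f m 0 * Determinant.det (Matrix.mat m m (\<lambda>(i, j). f i (Suc j)))"
proof -
  define A where "A = Matrix.mat (Suc m) (Suc m) (\<lambda>(i, j). f i j)"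
  have "Determinant.det A = (\<Sum>j<Suc m. A $$ (m, j) * cofactor A m j)"
    by (rule laplace_expansion_row) (simp_all add: A_def)
  also have "\<dots> = (\<Sum>j\<in>{0}. A $$ (m, j) * cofactor A m j)"
    using assms by (intro sum.mono_neutral_right) (auto simp: A_def)
  also have "\<dots> = (-1) ^ m * f m 0 * Determinant.det (mat_delete A m 0)"
    by (simp add: A_def cofactor_def)
  also have "mat_delete A m 0 = Matrix.mat m m (\<lambda>(i, j). f i (Suc j))"
    by (rule eq_matI) (auto simp: mat_delete_def A_def)
  finally show ?thesis by (simp add: A_def)
qed

section \<open>Summing determinants over products of sets\<close>

lemma has_sum_prod_PiE:
  fixes f :: "'a \<Rightarrow> 'b :: countable \<Rightarrow> complex"
  assumes "finite A" and "\<And>x. x \<in> A \<Longrightarrow> (f x has_sum S x) (B x)"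
  shows "((\<lambda>g. \<Prod>x\<in>A. f x (g x)) has_sum (\<Prod>x\<in>A. S x)) (PiE A B)"
proof -
  have abs: "Infinite_Sum.abs_summable_on (f x) (B x)" if "x \<in> A" for x
    using assms(2)[OF that] by (subst summable_on_iff_abs_summable_on_complex[symmetric]) (auto simp: summable_on_def)
  hence "Infinite_Sum.abs_summable_on (\<lambda>g. \<Prod>x\<in>A. f x (g x)) (PiE A B)"
    unfolding abs_summable_equivalent using assms(1)
    by (intro abs_summable_on_prod_PiE) auto
  hence "(\<lambda>g. \<Prod>x\<in>A. f x (g x)) summable_on (PiE A B)"
    by (rule abs_summable_summable)
  moreover have "infsum (\<lambda>g. \<Prod>x\<in>A. f x (g x)) (PiE A B) = (\<Prod>x\<in>A. infsum (f x) (B x))"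
    using assms(1) abs by (rule infsum_prod_PiE_abs)
  moreover have "\<dots> = (\<Prod>x\<in>A. S x)"
    using assms(2) by (intro prod.cong refl infsumI)
  ultimately show ?thesis by (simp add: has_sum_iff)
qed

lemma has_sum_finite_sum:
  fixes f :: "'a \<Rightarrow> 'b \<Rightarrow> 'c :: topological_comm_monoid_add"
  assumes "\<And>i. i \<in> I \<Longrightarrow> (f i has_sum S i) A"
  shows "((\<lambda>x. \<Sum>i\<in>I. f i x) has_sum (\<Sum>i\<in>I. S i)) A"
  using assms by (induction I rule: infinite_finite_induct) (auto intro: has_sum_add)

text \<open>Row i depends on \<open>x i\<close> alone, so every product in the Leibniz expansion is
  summed coordinate by coordinate.\<close>

lemma has_sum_det_PiE:
  fixes f :: "nat \<Rightarrow> 'b :: countable \<Rightarrow> complex"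
  assumes "\<And>i j. i < n \<Longrightarrow> j < n \<Longrightarrow> (f j has_sum S i j) (B i)"
  shows "((\<lambda>x. Determinant.det (Matrix.mat n n (\<lambda>(i, j). f j (x i)))) has_sum
    Determinant.det (Matrix.mat n n (\<lambda>(i, j). S i j))) (PiE {..<n} B)"
  unfolding det_eq_sum_permutations
proof (intro has_sum_finite_sum has_sum_cmult_right)
  fix p assume "p \<in> {p. p permutes {0..<n}}"
  hence "p i < n" if "i < n" for i
    using that permutes_in_image[of p "{0..<n}" i] by simp
  thus "((\<lambda>x. \<Prod>i<n. f (p i) (x i)) has_sum (\<Prod>i<n. S i (p i))) (PiE {..<n} B)"
    by (intro has_sum_prod_PiE) (use assms in simp_all)
qed

text \<open>With y (-1) read as infinity and y m as minus infinity these are the intervals [y i, y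
  (i - 1)); for weakly decreasing y and m > 0 they partition the integers.\<close>

definition interlacing_interval :: "nat \<Rightarrow> (nat \<Rightarrow> int) \<Rightarrow> nat \<Rightarrow> int set" where
  "interlacing_interval m y i =
     {x. (i < m \<longrightarrow> y i \<le> x) \<and> (0 < i \<longrightarrow> x < y (i - 1))}"

text \<open>The zero branches are the endpoints at plus and minus infinity, where \<open>G\<close>
  tends to 0.\<close>

lemma has_sum_interlacing_interval:
  fixes G :: "int \<Rightarrow> complex"
  assumes "i \<le> m" "m > 0" "\<And>i. Suc i < m \<Longrightarrow> y (Suc i) \<le> y i"
    and "(\<lambda>x. G (x + 1) - G x) summable_on UNIV"
    and "(\<lambda>n::nat. G (int n)) \<longlonglongrightarrow> 0" and "(\<lambda>n::nat. G (- int n)) \<longlonglongrightarrow> 0"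
  shows "((\<lambda>x. G (x + 1) - G x) has_sum
     ((if i = 0 then 0 else G (y (i - 1))) - (if i < m then G (y i) else 0))) (interlacing_interval m y i)"
proof -
  note summ = summable_on_subset[OF assms(4) subset_UNIV]
  consider "i = 0" | "0 < i" "i < m" | "i = m" using assms(1) by linarith
  thus ?thesis
  proof cases
    case 1
    with assms(2) have "interlacing_interval m y i = {y 0..}" by (auto simp: interlacing_interval_def)
    thus ?thesis using 1 assms(2) has_sum_telescope_atLeast[OF summ assms(5), of "y 0"] by simp
  next
    case 2
    hence "interlacing_interval m y i = {y i..<y (i - 1)}" by (auto simp: interlacing_interval_def)
    moreover have "y i \<le> y (i - 1)" using assms(3)[of "i - 1"] 2 by simp
    ultimately show ?thesis using 2 has_sum_telescope_Suc[of "y i" "y (i - 1)" G] by simp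
  next
    case 3
    hence "interlacing_interval m y i = {..<y (m - 1)}" using assms(2) by (auto simp: interlacing_interval_def)
    thus ?thesis using 3 assms(2) has_sum_telescope_lessThan[OF summ assms(6), of "y (m - 1)"] by simp
  qed
qed

lemma Un_interlacing_interval:
  assumes "\<And>i. Suc i < m \<Longrightarrow> y (Suc i) \<le> y i" and "k < m"
  shows "(\<Union>i\<le>k. interlacing_interval m y i) = {y k..}"
  using assms(2)
proof (induction k)
  case 0
  thus ?case by (auto simp: interlacing_interval_def)
next
  case (Suc k)
  have "(\<Union>i\<le>Suc k. interlacing_interval m y i) = {y k..} \<union> interlacing_interval m y (Suc k)"
    using Suc by (simp add: atMost_Suc sup_commute)
  also have "\<dots> = {y (Suc k)..}"
    using Suc.prems assms(1)[of k] by (auto simp: interlacing_interval_def)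
  finally show ?case .
qed

lemma disjoint_interlacing_interval:
  assumes "\<And>i. Suc i < m \<Longrightarrow> y (Suc i) \<le> y i" and "i < j" "j \<le> m"
  shows "interlacing_interval m y i \<inter> interlacing_interval m y j = {}"
proof -
  have "interlacing_interval m y i \<subseteq> {y (j - 1)..}"
    using Un_interlacing_interval[of m y "j - 1"] assms by fastforce
  moreover have "interlacing_interval m y j \<subseteq> {..<y (j - 1)}"
    using assms by (auto simp: interlacing_interval_def)
  ultimately show ?thesis by fastforce
qed

lemma sum_infsum_interlacing_intervals:
  fixes f :: "int \<Rightarrow> complex"
  assumes mono: "\<And>i. Suc i < m \<Longrightarrow> y (Suc i) \<le> y i" and m: "m > 0" and f: "f summable_on UNIV"
  shows "(\<Sum>i\<le>m. infsum f (interlacing_interval m y i)) = infsum f UNIV"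
proof -
  have "(\<Sum>i\<le>m. infsum f (interlacing_interval m y i)) = infsum f (\<Union>i\<le>m. interlacing_interval m y i)"
  proof (rule sum_infsum)
    show "f summable_on interlacing_interval m y i" for i
      by (rule summable_on_subset[OF f]) simp
    fix i j assume "i \<in> {..m}" "j \<in> {..m}" "i \<noteq> j"
    thus "interlacing_interval m y i \<inter> interlacing_interval m y j = {}"
      using disjoint_interlacing_interval[of m y i j, OF mono] disjoint_interlacing_interval[of m y j i, OF mono]
      by (metis Int_commute atMost_iff linorder_neqE_nat)
  qed simp
  also have "(\<Union>i\<le>m. interlacing_interval m y i) = UNIV"
  proof -
    from m obtain k where k: "m = Suc k" by (cases m) auto
    have "(\<Union>i\<le>k. interlacing_interval m y i) = {y k..}"
      by (rule Un_interlacing_interval) (use mono k in auto)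
    moreover have "{..m} = insert m {..k}" using k by auto
    ultimately have "(\<Union>i\<le>m. interlacing_interval m y i) = {y k..} \<union> interlacing_interval m y m"
      by auto
    also have "interlacing_interval m y m = {..<y k}"
      using k by (auto simp: interlacing_interval_def)
    finally show ?thesis by auto
  qed
  finally show ?thesis .
qed

text \<open>Adding up the first \<open>i\<close> rows telescopes all columns but the first, and the last row
becomes \<open>(infsum f UNIV, 0, \<dots>, 0)\<close>.\<close>

lemma has_sum_interlacing_vandermonde:
  fixes f g :: "int \<Rightarrow> complex" and p :: "nat \<Rightarrow> complex poly"
  assumes m: "m > 0" and mono: "\<And>i. Suc i < m \<Longrightarrow> y (Suc i) \<le> y i"
    and p0: "p 0 = 1" and deg: "\<And>j. j \<le> m \<Longrightarrow> degree (p j) \<le> j"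
    and diff: "\<And>j x. j < m \<Longrightarrow>
      f x * poly (p (Suc j)) (of_int x) = g (x + 1) * of_int (x + 1) ^ j - g x * of_int x ^ j"
    and summ: "\<And>j. j \<le> m \<Longrightarrow> (\<lambda>x. f x * poly (p j) (of_int x)) summable_on UNIV"
    and lim1: "\<And>j. j < m \<Longrightarrow> (\<lambda>n. g (int n) * of_int (int n) ^ j) \<longlonglongrightarrow> 0"
    and lim2: "\<And>j. j < m \<Longrightarrow> (\<lambda>n. g (- int n) * of_int (- int n) ^ j) \<longlonglongrightarrow> 0"
  shows "((\<lambda>x. (\<Prod>i\<le>m. f (x i)) * vandermonde_prod (Suc m) (\<lambda>i. of_int (x i)) * (\<Prod>j\<le>m. coeff (p j) j))
    has_sum (infsum f UNIV * (\<Prod>i<m. g (y i)) * vandermonde_prod m (\<lambda>i. of_int (y i))))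
    (PiE {..m} (interlacing_interval m y))"
proof -
  define F where "F = (\<lambda>j x. f x * poly (p j) (of_int x))"
  define G where "G = (\<lambda>j x. g x * of_int x ^ j)"
  define S where "S = (\<lambda>i j. infsum (F j) (interlacing_interval m y i))"
  have FG: "F (Suc j) = (\<lambda>x. G j (x + 1) - G j x)" if "j < m" for j
    using diff[OF that] by (simp add: F_def G_def)
  have F0: "F 0 = f" by (simp add: F_def p0)
  have S: "S i (Suc j) = (if i = 0 then 0 else G j (y (i - 1))) - (if i < m then G j (y i) else 0)"
    if "i \<le> m" "j < m" for i j
    unfolding S_def FG[OF that(2)]
  proof (rule infsumI, rule has_sum_interlacing_interval)
    show "i \<le> m" "m > 0" by fact+
    show "y (Suc k) \<le> y k" if "Suc k < m" for k using that by (rule mono)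
    show "(\<lambda>x. G j (x + 1) - G j x) summable_on UNIV"
      using summ[of "Suc j"] that(2) by (simp add: FG[symmetric] F_def)
    show "(\<lambda>n. G j (int n)) \<longlonglongrightarrow> 0" "(\<lambda>n. G j (- int n)) \<longlonglongrightarrow> 0"
      unfolding G_def using lim1[OF that(2)] lim2[OF that(2)] by simp_all
  qed
  have partial: "(\<Sum>k\<le>i. S k (Suc j)) = - (if i < m then G j (y i) else 0)" if "i \<le> m" "j < m" for i j
    using that(1)
  proof (induction i)
    case 0
    thus ?case using S[of 0 j] that by simp
  next
    case (Suc i)
    thus ?case using S[of "Suc i" j] that by simp
  qed
  have "((\<lambda>x. Determinant.det (Matrix.mat (Suc m) (Suc m) (\<lambda>(i, j). F j (x i)))) has_sum
    Determinant.det (Matrix.mat (Suc m) (Suc m) (\<lambda>(i, j). S i j))) (PiE {..<Suc m} (interlacing_interval m y))"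
    unfolding S_def
    by (intro has_sum_det_PiE has_sum_infsum)
       (use summ in \<open>auto simp: F_def intro: summable_on_subset[OF _ subset_UNIV]\<close>)
  also have "(\<lambda>x. Determinant.det (Matrix.mat (Suc m) (Suc m) (\<lambda>(i, j). F j (x i)))) =
    (\<lambda>x. (\<Prod>i\<le>m. f (x i)) * vandermonde_prod (Suc m) (\<lambda>i. of_int (x i)) * (\<Prod>j\<le>m. coeff (p j) j))"
    unfolding F_def using deg
    by (simp add: det_scale_rows det_poly_eval lessThan_Suc_atMost mult_ac)
  also have "Determinant.det (Matrix.mat (Suc m) (Suc m) (\<lambda>(i, j). S i j)) =
    Determinant.det (Matrix.mat (Suc m) (Suc m) (\<lambda>(i, j). \<Sum>k\<le>i. S k j))"
    by (rule det_partial_row_sums[symmetric])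
  also have "\<dots> = (-1) ^ m * (\<Sum>k\<le>m. S k 0) *
      Determinant.det (Matrix.mat m m (\<lambda>(i, j). \<Sum>k\<le>i. S k (Suc j)))"
  proof (rule det_last_row)
    fix j assume "0 < j" "j \<le> m"
    thus "(\<Sum>k\<le>m. S k j) = 0" using partial[of m "j - 1"] by simp
  qed
  also have "(\<Sum>k\<le>m. S k 0) = infsum f UNIV"
    unfolding S_def F0 by (rule sum_infsum_interlacing_intervals) (use mono m summ[of 0] p0 in simp_all)
  also have "Matrix.mat m m (\<lambda>(i, j). \<Sum>k\<le>i. S k (Suc j)) =
      Matrix.mat m m (\<lambda>(i, j). - g (y i) * of_int (y i) ^ j)"
    by (rule eq_matI) (simp_all add: partial G_def)
  also have "Determinant.det \<dots> = (\<Prod>i<m. - g (y i)) * vandermonde_prod m (\<lambda>i. of_int (y i))"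
    by (simp only: det_scale_rows det_vandermonde)
  also have "(\<Prod>i<m. - g (y i)) = (-1) ^ m * (\<Prod>i<m. g (y i))"
    by (simp add: prod_uminus)
  \<comment> \<open>One sign (-1)^m stems from the corner in the Laplace expansion, the other from
    the m negated rows.\<close>
  also have "(-1) ^ m * infsum f UNIV * ((-1) ^ m * (\<Prod>i<m. g (y i)) * vandermonde_prod m (\<lambda>i. of_int (y i)))
    = infsum f UNIV * (\<Prod>i<m. g (y i)) * vandermonde_prod m (\<lambda>i. of_int (y i))"
    by (simp add: mult_ac flip: power_add mult_2)
  finally show ?thesis by (simp only: lessThan_Suc_atMost)
qed

subsection \<open>Coherence of the zw-measures\<close>

lemma norm_poly_le:
  fixes p :: "complex poly"
  assumes "degree p \<le> k"
  shows "\<exists>C. \<forall>x. norm x \<ge> 1 \<longrightarrow> norm (poly p x) \<le> C * norm x ^ k"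
proof (intro exI allI impI)
  fix x :: complex assume x: "norm x \<ge> 1"
  have "norm (poly p x) \<le> (\<Sum>i\<le>degree p. norm (coeff p i * x ^ i))"
    unfolding poly_altdef by (rule norm_sum)
  also have "\<dots> \<le> (\<Sum>i\<le>degree p. norm (coeff p i) * norm x ^ k)"
    unfolding norm_mult norm_power
    by (intro sum_mono mult_left_mono power_increasing x) (use assms in simp_all)
  finally show "norm (poly p x) \<le> (\<Sum>i\<le>degree p. norm (coeff p i)) * norm x ^ k"
    by (simp add: sum_distrib_right)
qed

text \<open>With h n = n or h n = -n this serves both ends of the integers.\<close>

lemma bigo_mult_poly:
  fixes F :: "nat \<Rightarrow> complex" and p :: "complex poly"
  assumes F: "(\<lambda>n. norm (F n)) \<in> O(\<lambda>n. real n powr e)" and "degree p \<le> k"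
    and h: "\<And>n. norm (h n) = real n"
  shows "(\<lambda>n. norm (F n * poly p (h n))) \<in> O(\<lambda>n. real n powr (e + real k))"
proof -
  obtain C where C: "\<And>x. norm x \<ge> 1 \<Longrightarrow> norm (poly p x) \<le> C * norm x ^ k"
    using norm_poly_le[OF assms(2)] by blast
  have "(\<lambda>n. norm (poly p (h n))) \<in> O(\<lambda>n. real n powr real k)"
  proof (rule bigoI[where c = C], rule eventually_mono[OF eventually_gt_at_top[of 0]])
    fix n :: nat assume "0 < n"
    thus "norm (norm (poly p (h n))) \<le> C * norm (real n powr real k)"
      using C[of "h n"] by (simp add: h powr_realpow)
  qed
  from landau_o.big.mult[OF F this] show ?thesis
    by (simp add: norm_mult powr_add)
qed

text \<open>Multiplied by \<open>dougall_term (a + 1) (b + 1) c d\<close>, this polynomial is the forward difference of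
\<open>x ^ j * dougall_term a b c d x\<close>; its \<open>x ^ (j + 2)\<close> terms cancel.\<close>

definition diff_poly :: "complex \<Rightarrow> complex \<Rightarrow> complex \<Rightarrow> complex \<Rightarrow> nat \<Rightarrow> complex poly" where
  "diff_poly a b c d j =
     [:(c - 1) * (d - 1), 2 - c - d, 1:] * [:1, 1:] ^ j - [:a * b, a + b, 1:] * monom 1 j"

lemma coeff_diff_poly_Suc_Suc:
  "coeff (diff_poly a b c d j) (Suc (Suc k)) =
     (c - 1) * (d - 1) * of_nat (j choose Suc (Suc k)) + (2 - c - d) * of_nat (j choose Suc k) + of_nat (j choose k)
     - (if j = Suc (Suc k) then a * b else 0) - (if j = Suc k then a + b else 0) - (if j = k then 1 else 0)"
proof -
  have "coeff ([:1, 1:] ^ j) i = (of_nat (j choose i) :: complex)" for i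
    using coeff_linear_poly_power[of i j "1::complex" 1]
    by (cases "i \<le> j") (simp_all add: coeff_eq_0 degree_power_eq binomial_eq_0)
  thus ?thesis by (simp add: diff_poly_def)
qed

lemma degree_diff_poly: "degree (diff_poly a b c d j) \<le> Suc j"
proof (rule degree_le, intro allI impI)
  fix i assume i: "Suc j < i"
  hence "i = Suc (Suc (i - 2))" "j \<le> i - 2" by simp_all
  then obtain k where "i = Suc (Suc k)" "j \<le> k" by blast
  thus "coeff (diff_poly a b c d j) i = 0"
    by (auto simp: coeff_diff_poly_Suc_Suc binomial_eq_0)
qed

text \<open>At x ^ (j + 1) the first product contributes 2 - c - d from the top power of (1 + x) ^ j
  and j from the next one; the second contributes - (a + b).\<close>

lemma lead_coeff_diff_poly: "coeff (diff_poly a b c d j) (Suc j) = - (a + b + c + d - 2 - of_nat j)"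
proof (cases j)
  case 0
  thus ?thesis by (simp add: diff_poly_def)
next
  case (Suc k)
  thus ?thesis by (simp add: coeff_diff_poly_Suc_Suc del: binomial_Suc_Suc)
qed

lemma dougall_term_diff:
  "dougall_term (a + 1) (b + 1) c d x * poly (diff_poly a b c d j) (of_int x) =
   dougall_term a b c d (x + 1) * of_int (x + 1) ^ j - dougall_term a b c d x * of_int x ^ j"
proof -
  define x' :: complex where "x' = of_int x"
  have 1: "rGamma (a + x') = (a + x') * rGamma (a + 1 + x')"
    "rGamma (b + x') = (b + x') * rGamma (b + 1 + x')"
    "rGamma (c - (x' + 1)) = (c - x' - 1) * rGamma (c - x')"
    "rGamma (d - (x' + 1)) = (d - x' - 1) * rGamma (d - x')"
    by (subst rGamma_rec, simp add: algebra_simps)+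
  have 2: "a + (x' + 1) = a + 1 + x'" "b + (x' + 1) = b + 1 + x'" by simp_all
  have "poly (diff_poly a b c d j) x' =
      (c - x' - 1) * (d - x' - 1) * (x' + 1) ^ j - (a + x') * (b + x') * x' ^ j"
    by (simp add: diff_poly_def poly_monom algebra_simps)
  \<comment> \<open>Stated for arbitrary numbers, so that the powers and the Gamma factors stay
    unexpanded.\<close>
  moreover have "A * B * C * D * (u * v * P - p * q * R) =
      A * B * (u * C) * (v * D) * P - (p * A) * (q * B) * C * D * R" for A B C D u v P p q R :: complex
    by (simp add: right_diff_distrib mult_ac)
  ultimately show ?thesis
    unfolding dougall_term_def of_int_add of_int_1 x'_def[symmetric] 1 2 by simp
qed

text \<open>With S = Re (a + b + c + d), the column of degree m grows like n powr (m - S), exponent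
  below -1, and the largest telescoped function like n powr (m + 1 - S), exponent below 0. Both
  follow from S > m + 1.\<close>

lemma has_sum_interlacing_dougall:
  assumes m: "m > 0" and mono: "\<And>i. Suc i < m \<Longrightarrow> y (Suc i) \<le> y i"
    and s: "Re (a + b + c + d) > real m + 1"
  shows "((\<lambda>x. (\<Prod>i\<le>m. dougall_term (a + 1) (b + 1) c d (x i)) * vandermonde_prod (Suc m) (\<lambda>i. of_int (x i)) *
            ((-1) ^ m * (\<Prod>j<m. a + b + c + d - 2 - of_nat j)))
    has_sum (dougall_value (a + 1) (b + 1) c d *
       (\<Prod>i<m. dougall_term a b c d (y i)) * vandermonde_prod m (\<lambda>i. of_int (y i))))
    (PiE {..m} (interlacing_interval m y))"
proof -
  define p where "p = (\<lambda>j. case j of 0 \<Rightarrow> 1 | Suc j \<Rightarrow> diff_poly a b c d j)"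
  have p0: "p 0 = 1" by (simp add: p_def)
  have p_Suc: "p (Suc j) = diff_poly a b c d j" for j by (simp add: p_def)
  have deg: "degree (p j) \<le> j" for j
    by (cases j) (simp_all add: p0 p_Suc degree_diff_poly)
  have "(\<Prod>j\<le>m. coeff (p j) j) = (\<Prod>j<m. coeff (p (Suc j)) (Suc j))"
    by (simp add: prod.atMost_shift p0)
  also have "\<dots> = (\<Prod>j<m. (-1) * (a + b + c + d - 2 - of_nat j))"
    by (simp add: p_Suc lead_coeff_diff_poly)
  also have "\<dots> = (-1) ^ m * (\<Prod>j<m. a + b + c + d - 2 - of_nat j)"
    unfolding prod.distrib by simp
  finally have lead: "(\<Prod>j\<le>m. coeff (p j) j) = (-1) ^ m * (\<Prod>j<m. a + b + c + d - 2 - of_nat j)" .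
  have s': "Re (a + 1 + (b + 1) + c + d) > 3" using s m by simp
  have total: "infsum (dougall_term (a + 1) (b + 1) c d) UNIV = dougall_value (a + 1) (b + 1) c d"
    by (rule infsumI[OF dougall_bilateral_sum[OF s']])
  show ?thesis
    unfolding lead[symmetric] total[symmetric]
  proof (rule has_sum_interlacing_vandermonde[OF m])
    show "y (Suc i) \<le> y i" if "Suc i < m" for i using that by (rule mono)
    show "p 0 = 1" "degree (p j) \<le> j" for j by (rule p0 deg)+
  next
    fix j x assume "j < m"
    show "dougall_term (a + 1) (b + 1) c d x * poly (p (Suc j)) (of_int x) =
        dougall_term a b c d (x + 1) * of_int (x + 1) ^ j - dougall_term a b c d x * of_int x ^ j"
      unfolding p_Suc by (rule dougall_term_diff)
  next
    fix j assume j: "j \<le> m"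
    have e: "2 - Re (a + 1 + (b + 1) + c + d) + real j < -1" using s j by simp
    show "(\<lambda>x. dougall_term (a + 1) (b + 1) c d x * poly (p j) (of_int x)) summable_on UNIV"
      by (rule bigo_powr_imp_summable_on_int[OF _ _ e];
          rule bigo_mult_poly[OF dougall_term_bigo deg] bigo_mult_poly[OF dougall_term_bigo' deg]; simp)
  next
    fix j assume j: "j < m"
    have e: "2 - Re (a + b + c + d) + real j < 0" using s j by simp
    have deg': "degree (monom 1 j :: complex poly) \<le> j" by (simp add: degree_monom_le)
    show "(\<lambda>n. dougall_term a b c d (int n) * of_int (int n) ^ j) \<longlonglongrightarrow> 0"
      using bigo_powr_neg_imp_tendsto_0[OF bigo_mult_poly[OF dougall_term_bigo deg', of of_nat] e]
      by (simp add: poly_monom)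
    show "(\<lambda>n. dougall_term a b c d (- int n) * of_int (- int n) ^ j) \<longlonglongrightarrow> 0"
      using bigo_powr_neg_imp_tendsto_0[OF bigo_mult_poly[OF dougall_term_bigo' deg', of "\<lambda>n. - of_nat n"] e]
      by (simp add: poly_monom)
  qed
qed

section \<open>Signatures in shifted coordinates\<close>

definition shifted :: "int list \<Rightarrow> nat \<Rightarrow> int" where
  "shifted \<nu> i = \<nu> ! i - int i - 1"

text \<open>For each j the differences to all k < j enter with the opposite sign, giving (-1) ^ j,
  and their denominators multiply to \<open>fact j\<close>.\<close>

lemma Dim_eq_vandermonde_prod:
  "complex_of_real (Dim N \<nu>) =
     (\<Prod>j<N. (-1) ^ j / fact j) * vandermonde_prod N (\<lambda>i. of_int (shifted \<nu> i))"
proof -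
  have "Dim N \<nu> = (\<Prod>(j, k)\<in>(SIGMA j:{..<N}. {..<j}).
      - real_of_int (shifted \<nu> j - shifted \<nu> k) / (real j - real k))"
    unfolding Dim_def
    by (rule prod.reindex_bij_witness[of _ "\<lambda>(j, k). (Suc k, Suc j)" "\<lambda>(i, j). (j - 1, i - 1)"])
       (auto simp: sig_at_def shifted_def)
  also have "\<dots> = (\<Prod>j<N. \<Prod>k<j. - real_of_int (shifted \<nu> j - shifted \<nu> k) / (real j - real k))"
    by (subst prod.Sigma) simp_all
  also have "\<dots> = (\<Prod>j<N. (-1) ^ j / fact j * (\<Prod>k<j. real_of_int (shifted \<nu> j - shifted \<nu> k)))"
  proof (rule prod.cong[OF refl])
    fix j
    have "(\<Prod>k<j. real j - real k) = fact j"
      by (simp add: fact_prod_rev atLeast0LessThan of_nat_diff)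
    moreover have "(\<Prod>k<j. - real_of_int (shifted \<nu> j - shifted \<nu> k)) =
        (-1) ^ j * (\<Prod>k<j. real_of_int (shifted \<nu> j - shifted \<nu> k))"
      using prod.distrib[of "\<lambda>_. - 1" "\<lambda>k. real_of_int (shifted \<nu> j - shifted \<nu> k)" "{..<j}"] by simp
    ultimately show "(\<Prod>k<j. - real_of_int (shifted \<nu> j - shifted \<nu> k) / (real j - real k)) =
        (-1) ^ j / fact j * (\<Prod>k<j. real_of_int (shifted \<nu> j - shifted \<nu> k))"
      by (simp add: prod_dividef)
  qed
  also have "\<dots> = (\<Prod>j<N. (-1) ^ j / fact j) * (\<Prod>j<N. \<Prod>k<j. real_of_int (shifted \<nu> j - shifted \<nu> k))"
    by (rule prod.distrib)
  finally show ?thesis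
    unfolding vandermonde_prod_def by (simp only: of_real_mult of_real_prod) simp
qed

lemma zwM'_eq_dougall_term:
  "zwM' z z' w w' N \<nu> =
     (\<Prod>i<N. dougall_term (w + of_nat N + 1) (w' + of_nat N + 1) z z' (shifted \<nu> i)) *
     (complex_of_real (Dim N \<nu>))\<^sup>2"
proof -
  have "(\<Prod>i=1..N. rGamma (z - of_int (sig_at \<nu> i) + of_nat i)
              * rGamma (z' - of_int (sig_at \<nu> i) + of_nat i)
              * rGamma (w + of_nat N + 1 + of_int (sig_at \<nu> i) - of_nat i)
              * rGamma (w' + of_nat N + 1 + of_int (sig_at \<nu> i) - of_nat i))
     = (\<Prod>i<N. dougall_term (w + of_nat N + 1) (w' + of_nat N + 1) z z' (shifted \<nu> i))"
    by (rule prod.reindex_bij_witness[of _ Suc "\<lambda>i. i - 1"])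
       (auto simp: dougall_term_def shifted_def sig_at_def algebra_simps)
  thus ?thesis by (simp add: zwM'_def)
qed

lemma bij_betw_interlacing:
  assumes "length \<mu> = m"
  shows "bij_betw (\<lambda>x. map (\<lambda>i. x i + int i + 1) [0..<Suc m])
    (PiE {..m} (interlacing_interval m (shifted \<mu>))) {\<nu> \<in> sigs (Suc m). interlace (Suc m) \<mu> \<nu>}"
proof -
  have inter: "interlace (Suc m) \<mu> \<nu> \<longleftrightarrow> (\<forall>i<m. \<mu> ! i \<le> \<nu> ! i \<and> \<nu> ! Suc i \<le> \<mu> ! i)" for \<nu>
  proof -
    have "{1..<Suc m} = Suc ` {..<m}" 
      by (simp add: lessThan_atLeast0 image_Suc_atLeastLessThan)
    thus ?thesis by (auto simp: interlace_def sig_at_def)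
  qed
  \<comment> \<open>Interlacing already forces weak decrease, so the coordinates vary independently
    and the set is a product.\<close>
  have sigs: "\<nu> \<in> sigs (Suc m)" if "length \<nu> = Suc m" "interlace (Suc m) \<mu> \<nu>" for \<nu>
    using that by (force simp: sigs_def interlace_def)
  show ?thesis
  proof (rule bij_betwI[where g = "\<lambda>\<nu>. restrict (shifted \<nu>) {..m}"])
    show "(\<lambda>x. map (\<lambda>i. x i + int i + 1) [0..<Suc m]) \<in>
        PiE {..m} (interlacing_interval m (shifted \<mu>)) \<rightarrow> {\<nu> \<in> sigs (Suc m). interlace (Suc m) \<mu> \<nu>}"
    proof
      fix x assume x: "x \<in> PiE {..m} (interlacing_interval m (shifted \<mu>))"
      \<comment> \<open>The shifts at places i and i + 1 differ by 1, which turns the weak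
        inequality between \<open>\<nu> ! Suc i\<close> and \<open>\<mu> ! i\<close> into the strict
        one of the interval.\<close>
      have "\<mu> ! i \<le> x i + int i + 1 \<and> x (Suc i) + int (Suc i) + 1 \<le> \<mu> ! i" if "i < m" for i
        using PiE_mem[OF x, of i] PiE_mem[OF x, of "Suc i"] that
        by (auto simp: interlacing_interval_def shifted_def)
      hence "interlace (Suc m) \<mu> (map (\<lambda>i. x i + int i + 1) [0..<Suc m])"
        unfolding inter by (simp del: upt_Suc)
      with sigs show "map (\<lambda>i. x i + int i + 1) [0..<Suc m] \<in> {\<nu> \<in> sigs (Suc m). interlace (Suc m) \<mu> \<nu>}"
        by simp
    qed
    show "(\<lambda>\<nu>. restrict (shifted \<nu>) {..m}) \<in> {\<nu> \<in> sigs (Suc m). interlace (Suc m) \<mu> \<nu>} \<rightarrow>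
        PiE {..m} (interlacing_interval m (shifted \<mu>))"
    proof (intro funcsetI PiE_I)
      fix \<nu> i assume \<nu>: "\<nu> \<in> {\<nu> \<in> sigs (Suc m). interlace (Suc m) \<mu> \<nu>}" and "i \<in> {..m}"
      hence "i < m \<longrightarrow> \<mu> ! i \<le> \<nu> ! i" "0 < i \<longrightarrow> \<nu> ! i \<le> \<mu> ! (i - 1)"
        using inter by (auto simp: gr0_conv_Suc)
      thus "restrict (shifted \<nu>) {..m} i \<in> interlacing_interval m (shifted \<mu>) i"
        using \<open>i \<in> {..m}\<close> by (auto simp: interlacing_interval_def shifted_def)
    qed simp
    show "restrict (shifted (map (\<lambda>i. x i + int i + 1) [0..<Suc m])) {..m} = x"
      if "x \<in> PiE {..m} (interlacing_interval m (shifted \<mu>))" for x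
      using that by (intro ext) (auto simp: shifted_def restrict_def PiE_def extensional_def simp del: upt_Suc)
    show "map (\<lambda>i. restrict (shifted \<nu>) {..m} i + int i + 1) [0..<Suc m] = \<nu>"
      if "\<nu> \<in> {\<nu> \<in> sigs (Suc m). interlace (Suc m) \<mu> \<nu>}" for \<nu>
      using that by (intro nth_equalityI) (auto simp: sigs_def shifted_def simp del: upt_Suc)
  qed
qed

text \<open>Otherwise z + w = -n with n >= 1. If z is not real, then z' and w' are the conjugates
  and the four parameters have real sum -2n. If all are real, let p be the floor of z: then z' < p +
  1, and w + n + p = p - z < 0 forces w' < -n - p, so the total is below 1 - 2n <= -1.\<close>

lemma admissible_sum_not_nonpos_Int:
  assumes "admissible z z' w w'" and "N \<ge> 1"
  shows "z + w + of_nat N \<notin> \<int>\<^sub>\<le>\<^sub>0"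
proof
  assume "z + w + of_nat N \<in> \<int>\<^sub>\<le>\<^sub>0"
  then obtain k where k: "z + w + of_nat N = of_int k" "k \<le> 0" by (auto elim!: nonpos_Ints_cases)
  define n where "n = int N - k"
  have n: "n \<ge> 1" using assms(2) k by (simp add: n_def)
  have Re_w: "Re w = - of_int n - Re z" and Im_w: "Im w = - Im z"
    using arg_cong[OF k(1), of Re] arg_cong[OF k(1), of Im] by (simp_all add: n_def)
  have pos: "Im ((z + of_int k) * (z' + of_int k)) = 0" "Re ((z + of_int k) * (z' + of_int k)) > 0"
    "Im ((w + of_int k) * (w' + of_int k)) = 0" "Re ((w + of_int k) * (w' + of_int k)) > 0" for k
    using assms(1) by (auto simp: admissible_def pos_complex_def)
  have sum: "Re z + Re z' + Re w + Re w' > -1"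
    using assms(1) by (simp add: admissible_def)
  \<comment> \<open>The imaginary part of (u + k) (v + k) is affine in k with slope Im u + Im v; so
    u and v are both real or conjugate.\<close>
  have conj: "Im v = - Im u \<and> Im u * (Re v - Re u) = 0"
    if "\<And>k. Im ((u + of_int k) * (v + of_int k)) = 0" for u v
  proof -
    have "Im v = - Im u" using that[of 0] that[of 1] by (simp add: algebra_simps)
    thus ?thesis using that[of 0] by (simp add: algebra_simps)
  qed
  from conj[of z z'] conj[of w w'] pos
  have z: "Im z' = - Im z" "Im z * (Re z' - Re z) = 0" and w: "Im w' = - Im w" "Im w * (Re w' - Re w) = 0"
    by blast+
  show False
  proof (cases "Im z = 0")
    case False
    hence "Re z' = Re z" "Re w' = Re w" using z w Im_w by auto
    thus False using sum Re_w n by simp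
  next
    case True
    have zk: "(Re z + of_int k) * (Re z' + of_int k) > 0" and wk: "(Re w + of_int k) * (Re w' + of_int k) > 0" for k
      using pos(2,4)[of k] True z w Im_w by simp_all
    define p where "p = \<lfloor>Re z\<rfloor>"
    have "Re z - of_int p > 0"
    proof -
      have "Re z \<noteq> of_int p" using zk[of "- p"] by auto
      moreover have "of_int p \<le> Re z" by (simp add: p_def)
      ultimately show ?thesis by linarith
    qed
    hence "Re w' + of_int (n + p) < 0"
      using wk[of "n + p"] Re_w by (simp add: zero_less_mult_iff)
    moreover have "Re z - of_int (p + 1) < 0"
      using floor_correct[of "Re z"] unfolding p_def by simp
    hence "Re z' - of_int (p + 1) < 0"
      using zk[of "- (p + 1)"] by (simp add: zero_less_mult_iff)
    ultimately show False using sum Re_w n by simp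
  qed
qed

lemma admissible_swap:
  assumes "admissible z z' w w'"
  shows "admissible z' z w w'" "admissible z z' w' w"
  using assms by (simp_all add: admissible_def mult.commute add_ac)

theorem theorem4:
  fixes z z' w w' :: complex and N :: nat and \<mu> :: "int list"
  assumes "admissible z z' w w'"
    and "N \<ge> 2"
    and "\<mu> \<in> sigs (N - 1)"
  shows "((\<lambda>\<nu>. zwM z z' w w' N \<nu> * complex_of_real (link N \<nu> \<mu>))
           has_sum zwM z z' w w' (N - 1) \<mu>) (sigs N)"
proof -
  obtain m where N: "N = Suc m" and m: "m > 0"
    using assms(2) by (cases N) auto
  have len: "length \<mu> = m" using assms(3) by (simp add: N sigs_def)
  define s where "s = z + z' + w + w'"
  \<comment> \<open>These are the parameters of the weight at level m = N - 1; those at level N are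
    a + 1 and b + 1.\<close>
  define a b where "a = w + of_nat N" and "b = w' + of_nat N"
  define y where "y = shifted \<mu>"
  define f where "f = dougall_term (a + 1) (b + 1) z z'"
  define g where "g = dougall_term a b z z'"
  define K where "K = (\<lambda>n. \<Prod>j<n. (-1) ^ j / fact j :: complex)"
  define Q where "Q = (\<Prod>j<m. a + b + z + z' - 2 - of_nat j)"
  \<comment> \<open>The last factor of \<open>zwC\<close> at level N, that is, the quotient of the
    two normalisations.\<close>
  define r where "r = Gamma (s + of_nat N) / (Gamma (z + w + of_nat N) * Gamma (z + w' + of_nat N)
    * Gamma (z' + w + of_nat N) * Gamma (z' + w' + of_nat N) * Gamma (of_nat N))"
  have s: "Re s > -1" using assms(1) by (simp add: admissible_def s_def)
  have abs: "a + b + z + z' = s + 2 * of_nat N" by (simp add: a_def b_def s_def)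
  have sN: "s + of_nat N \<notin> \<int>\<^sub>\<le>\<^sub>0"
    by (rule pos_Re_not_nonpos_Int) (use s N in simp)
  have C_N: "zwC z z' w w' N = zwC z z' w w' m * r"
    by (simp add: zwC_def N r_def s_def)
  \<comment> \<open>As N = m + 1, the factors s + 2N - 2 - j descend from s + N + m - 1 to s +
    N.\<close>
  have Q: "Q = pochhammer (s + of_nat N) m"
    unfolding Q_def abs pochhammer_prod_rev
    by (rule prod.reindex_bij_witness[of _ "\<lambda>j. j - 1" Suc])
       (auto simp: N of_nat_diff)
  have Q_Gamma: "Gamma (s + of_nat N + of_nat m) = Q * Gamma (s + of_nat N)"
    using pochhammer_Gamma[OF sN, of m] sN by (simp add: Q Gamma_eq_zero_iff)
  have Q_nz: "Q \<noteq> 0"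
    using sN pochhammer_eq_0_imp_nonpos_Int unfolding Q by blast
  have nonpos: "z + w + of_nat N \<notin> \<int>\<^sub>\<le>\<^sub>0" "z + w' + of_nat N \<notin> \<int>\<^sub>\<le>\<^sub>0"
    "z' + w + of_nat N \<notin> \<int>\<^sub>\<le>\<^sub>0" "z' + w' + of_nat N \<notin> \<int>\<^sub>\<le>\<^sub>0"
    using assms(1,2) admissible_swap admissible_sum_not_nonpos_Int by (meson le_trans one_le_numeral)+
  have Gamma_N: "Gamma (of_nat N) = (fact m :: complex)"
    using Gamma_fact[of m, where 'a = complex] by (simp add: N add_ac)
  have r_nz: "r \<noteq> 0"
    using nonpos sN unfolding r_def Gamma_N by (simp add: Gamma_eq_zero_iff)
  \<comment> \<open>The total mass of \<open>f\<close> supplies exactly the quotient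
    \<open>r\<close> of normalisations; Q cancels the leading coefficients and \<open>fact m\<close>
    the quotient of \<open>K N\<close> and \<open>K m\<close>, up to sign.\<close>
  have D: "dougall_value (a + 1) (b + 1) z z' = Q * fact m * r"
  proof -
    have args: "a + 1 + (b + 1) + z + z' - 3 = s + of_nat N + of_nat m"
      "a + 1 + z - 1 = z + w + of_nat N" "a + 1 + z' - 1 = z' + w + of_nat N"
      "b + 1 + z - 1 = z + w' + of_nat N" "b + 1 + z' - 1 = z' + w' + of_nat N"
      by (simp_all add: a_def b_def s_def N)
    show ?thesis
      unfolding dougall_value_def args Q_Gamma r_def Gamma_N by (simp add: rGamma_inverse_Gamma field_simps)
  qed
  have Dim: "complex_of_real (Dim n \<nu>) = K n * vandermonde_prod n (\<lambda>i. of_int (shifted \<nu> i))" for n \<nu>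
    unfolding K_def by (rule Dim_eq_vandermonde_prod)
  have K_N: "K N = K m * ((-1) ^ m / fact m)" by (simp add: K_def N)
  have M_m: "zwM' z z' w w' m \<mu> = (\<Prod>i<m. g (y i)) * (complex_of_real (Dim m \<mu>))\<^sup>2"
    unfolding zwM'_eq_dougall_term g_def y_def a_def b_def by (simp add: N add_ac)
  have M_N: "zwM' z z' w w' N \<nu> = (\<Prod>i\<le>m. f (shifted \<nu> i)) * (complex_of_real (Dim N \<nu>))\<^sup>2" for \<nu>
    unfolding zwM'_eq_dougall_term f_def a_def b_def by (simp add: N lessThan_Suc_atMost)

  \<comment> \<open>The link cancels one of the two factors \<open>Dim N \<nu>\<close> and brings in
    \<open>Dim m \<mu>\<close>; the other \<open>Dim N \<nu>\<close> is \<open>K N\<close> times the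
    Vandermonde product in \<open>\<Phi>\<close>.\<close>
  define \<kappa> where "\<kappa> = K N * complex_of_real (Dim m \<mu>) / (zwC z z' w w' N * ((-1) ^ m * Q))"
  define t where "t = (\<lambda>\<nu>. zwM z z' w w' N \<nu> * complex_of_real (link N \<nu> \<mu>))"
  define \<Phi> where "\<Phi> = (\<lambda>x :: nat \<Rightarrow> int. (\<Prod>i\<le>m. f (x i)) * vandermonde_prod (Suc m) (\<lambda>i. of_int (x i)) * ((-1) ^ m * Q))"
  have "(\<Phi> has_sum (dougall_value (a + 1) (b + 1) z z' * (\<Prod>i<m. g (y i)) * vandermonde_prod m (\<lambda>i. of_int (y i))))
      (PiE {..m} (interlacing_interval m y))"
    unfolding \<Phi>_def Q_def f_def g_def
  proof (rule has_sum_interlacing_dougall[OF m])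
    fix i assume i: "Suc i < m"
    hence "sig_at \<mu> (Suc i) \<ge> sig_at \<mu> (Suc i + 1)"
      using assms(3) by (simp add: sigs_def N)
    thus "y (Suc i) \<le> y i" by (simp add: y_def shifted_def sig_at_def)
  next
    show "Re (a + b + z + z') > real m + 1" unfolding abs using s by (simp add: N)
  qed
  from has_sum_cmult_right[OF this, of \<kappa>]
  have sum_\<Phi>: "((\<lambda>x. \<kappa> * \<Phi> x) has_sum zwM z z' w w' m \<mu>) (PiE {..m} (interlacing_interval m y))"
  proof (rule back_subst[where P = "\<lambda>S. ((\<lambda>x. \<kappa> * \<Phi> x) has_sum S) (PiE {..m} (interlacing_interval m y))"])
    have "\<kappa> * (dougall_value (a + 1) (b + 1) z z' * (\<Prod>i<m. g (y i)) * vandermonde_prod m (\<lambda>i. of_int (y i)))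
      = complex_of_real (Dim m \<mu>) * (K m * vandermonde_prod m (\<lambda>i. of_int (y i))) * (\<Prod>i<m. g (y i)) / zwC z z' w w' m"
      unfolding \<kappa>_def K_N C_N D using Q_nz r_nz by (simp add: field_simps)
    also have "K m * vandermonde_prod m (\<lambda>i. of_int (y i)) = complex_of_real (Dim m \<mu>)"
      unfolding y_def by (rule Dim[symmetric])
    finally show "\<kappa> * (dougall_value (a + 1) (b + 1) z z' * (\<Prod>i<m. g (y i)) * vandermonde_prod m (\<lambda>i. of_int (y i)))
      = zwM z z' w w' m \<mu>"
      by (simp add: zwM_def M_m power2_eq_square mult_ac)
  qed
  have t_eq: "t (map (\<lambda>i. x i + int i + 1) [0..<Suc m]) = \<kappa> * \<Phi> x"
    if x: "x \<in> PiE {..m} (interlacing_interval m y)" for x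
  proof -
    define \<nu> where "\<nu> = map (\<lambda>i. x i + int i + 1) [0..<Suc m]"
    have "interlace N \<mu> \<nu>"
      using bij_betw_apply[OF bij_betw_interlacing[OF len]] x unfolding \<nu>_def y_def N by blast
    \<comment> \<open>In the case of a vanishing \<open>Dim N \<nu>\<close> both sides are 0,
      division by 0 being 0.\<close>
    hence "t \<nu> = (\<Prod>i\<le>m. f (shifted \<nu> i)) * complex_of_real (Dim N \<nu>) * complex_of_real (Dim m \<mu>) / zwC z z' w w' N"
      unfolding t_def zwM_def link_def M_N
      by (cases "Dim N \<nu> = 0") (simp_all add: N power2_eq_square)
    also have "(\<Prod>i\<le>m. f (shifted \<nu> i)) = (\<Prod>i\<le>m. f (x i))"
      by (intro prod.cong) (auto simp: shifted_def \<nu>_def simp del: upt_Suc)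
    also have "complex_of_real (Dim N \<nu>) = K N * vandermonde_prod (Suc m) (\<lambda>i. of_int (x i))"
      unfolding Dim unfolding N vandermonde_prod_def
      by (intro arg_cong2[where f = times] prod.cong refl) (auto simp: shifted_def \<nu>_def simp del: upt_Suc)
    finally show ?thesis
      unfolding \<nu>_def[symmetric] \<Phi>_def \<kappa>_def using Q_nz by (simp add: field_simps)
  qed
  have "(t has_sum zwM z z' w w' m \<mu>) {\<nu> \<in> sigs (Suc m). interlace (Suc m) \<mu> \<nu>}"
    unfolding has_sum_reindex_bij_betw[OF bij_betw_interlacing[OF len], symmetric] y_def[symmetric]
    using sum_\<Phi> by (subst has_sum_cong[OF t_eq]) simp_all
  \<comment> \<open>Signatures that do not interlace with \<open>\<mu>\<close> have link 0.\<close>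
  hence "(t has_sum zwM z z' w w' m \<mu>) (sigs N)"
    by (rule has_sum_cong_neutral[THEN iffD1, rotated -1]) (auto simp: N t_def link_def)
  thus ?thesis by (simp add: t_def N)
qed

end
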